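(* Let $I=(-\frac{\pi}{2},\frac{\pi}{2})$ and let $$\lambda(z)=\frac{1}{\sqrt{2\pi}}\,z^{\frac12-z}\,e^z\,\Gamma(z),\qquad z\in\mathbb C\setminus\mathbb R^-,$$ where $\Gamma$ is Euler's gamma function and $z^{\frac12-z}=e^{(\frac12-z)\mathrm{Log}\,z}$ with the principal branch of the logarithm. Then $\lambda$ can be written $\lambda=e^{\mathcal S^I\tilde\mu}$, where $\tilde\mu(z)\in z^{-1}\mathbb C[[z^{-1}]]$ is a divergent odd formal series which is $1$-summable in the directions of $I$, whose formal Borel transform $\hat\mu=\mathcal B\tilde\mu$ belongs to $\mathcal N(I,0)$ and is explicitly given by $$\hat\mu(\zeta)=\zeta^{-2}\Bigl(\frac{\zeta}{2}\coth\frac{\zeta}{2}-1\Bigr),\qquad \zeta\in\mathbb C\setminus(\Delta^+\cup\Delta^-),$$ where $\Delta^\pm$ is the half-line $\pm2\pi\mathrm i\,[1,+\infty)$, and whose Borel sum $\mathcal S^I\tilde\mu$ is holomorphic in the cut plane $\mathcal D(I,0)=\mathbb C\setminus\mathbb R^-$.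
   Context: $\mathbb R^-=(-\infty,0]$. The formal Borel transform is $\mathcal B\bigl(\sum_{n\ge0}a_nz^{-n-1}\bigr)=\sum_{n\ge0}a_n\frac{\zeta^n}{n!}$. For an open interval $I\subset\mathbb R$ and locally bounded $\gamma:I\to\mathbb R$, $\mathcal N(I,\gamma)$ is the set of convergent power series $\hat\varphi\in\mathbb C\{\zeta\}$ that extend analytically to the open sector $\{\xi e^{\mathrm i\theta}\mid\xi>0,\ \theta\in I\}$ and for which there is a locally bounded $\alpha:I\to\mathbb R^+$ with $|\hat\varphi(\xi e^{\mathrm i\theta})|\le\alpha(\theta)e^{\gamma(\theta)\xi}$ for all $\xi>0$, $\theta\in I$. A formal series $\tilde\varphi\in z^{-1}\mathbb C[[z^{-1}]]$ is $1$-summable in the directions of $I$ if $\mathcal B\tilde\varphi\in\mathcal N(I,\gamma)$ for some locally bounded $\gamma$. Put $\Pi^\theta_c=\{z\in\mathbb C\mid\mathrm{Re}(ze^{\mathrm i\theta})>c\}$ and $\mathcal D(I,\gamma)=\bigcup_{\theta\in I}\Pi^\theta_{\gamma(\theta)}$ (for $|I|\le\pi$). The Borel sum $\mathcal S^I\tilde\varphi$ is the function on $\mathcal D(I,\gamma)$ defined by $\mathcal S^I\tilde\varphi(z)=\int_0^{+\infty}e^{-z\xi e^{\mathrm i\theta}}\hat\varphi(\xi e^{\mathrm i\theta})e^{\mathrm i\theta}\,d\xi$ for any $\theta\in I$ such that $z\in\Pi^\theta_{\gamma(\theta)}$, where $\hat\varphi=\mathcal B\tilde\varphi$ (the value does not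 depend on the choice of $\theta$). $\mathcal N(I,0)$ and $\mathcal D(I,0)$ refer to $\gamma\equiv0$. "Divergent" means having zero radius of convergence in $z^{-1}$. *)

theory Defs
  imports "HOL-Analysis.Analysis"
begin

text \<open>
  A formal series in \<open>\<complex>[[z\<^sup>-\<^sup>1]]\<close> is encoded as a \<open>complex fps\<close> in the variable \<open>w = z\<^sup>-\<^sup>1\<close>:
  the coefficient of \<open>z\<^sup>-\<^sup>n\<close> is \<open>fps_nth \<phi> n\<close>.  Hence \<open>\<phi> \<in> z\<^sup>-\<^sup>1\<complex>[[z\<^sup>-\<^sup>1]]\<close> means that
  \<open>fps_nth \<phi> 0 = 0\<close>, and in \<open>\<Sum>n. a\<^sub>n z\<^sup>-\<^sup>n\<^sup>-\<^sup>1\<close> the coefficient \<open>a\<^sub>n\<close> is \<open>fps_nth \<phi> (Suc n)\<close>.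
\<close>

definition formal_borel :: "complex fps \<Rightarrow> complex fps" where
  "formal_borel \<phi> = Abs_fps (\<lambda>n. fps_nth \<phi> (Suc n) / fact n)"

definition fps_odd :: "complex fps \<Rightarrow> bool" where
  "fps_odd \<phi> \<longleftrightarrow> fps_compose \<phi> (- fps_X) = - \<phi>"

definition fps_divergent :: "complex fps \<Rightarrow> bool" where
  "fps_divergent \<phi> \<longleftrightarrow> fps_conv_radius \<phi> = 0"

definition locally_bounded_on :: "real set \<Rightarrow> (real \<Rightarrow> real) \<Rightarrow> bool" where
  "locally_bounded_on I \<gamma> \<longleftrightarrow>
     (\<forall>\<theta>\<in>I. \<exists>U. open U \<and> \<theta> \<in> U \<and> bounded (\<gamma> ` (U \<inter> I)))"

definition open_sector :: "real set \<Rightarrow> complex set" where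
  "open_sector I = {of_real \<xi> * cis \<theta> | \<xi> \<theta>. \<xi> > 0 \<and> \<theta> \<in> I}"

text \<open>
  \<open>f\<close> is the analytic continuation of the germ at \<open>0\<close> given by the (convergent) power series
  \<open>F\<close> to \<open>U\<close>.  The set \<open>U\<close> need not contain \<open>0\<close>, as is the case for sectors; note that
  \<open>f has_fps_expansion F\<close> includes that \<open>F\<close> has positive radius of convergence.
\<close>

definition continues_germ_to :: "(complex \<Rightarrow> complex) \<Rightarrow> complex fps \<Rightarrow> complex set \<Rightarrow> bool" where
  "continues_germ_to f F U \<longleftrightarrow> f has_fps_expansion F \<and> f holomorphic_on U"

definition borel_class :: "real set \<Rightarrow> (real \<Rightarrow> real) \<Rightarrow> complex fps set" where
  "borel_class I \<gamma> = {F. \<exists>f \<alpha>. continues_germ_to f F (open_sector I) \<and>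
     locally_bounded_on I \<alpha> \<and> (\<forall>\<theta>\<in>I. \<alpha> \<theta> \<ge> 0) \<and>
     (\<forall>\<xi>>0. \<forall>\<theta>\<in>I. norm (f (of_real \<xi> * cis \<theta>)) \<le> \<alpha> \<theta> * exp (\<gamma> \<theta> * \<xi>))}"

definition one_summable :: "real set \<Rightarrow> complex fps \<Rightarrow> bool" where
  "one_summable I \<phi> \<longleftrightarrow> fps_nth \<phi> 0 = 0 \<and>
     (\<exists>\<gamma>. locally_bounded_on I \<gamma> \<and> formal_borel \<phi> \<in> borel_class I \<gamma>)"

definition half_plane :: "real \<Rightarrow> real \<Rightarrow> complex set" where
  "half_plane \<theta> c = {z. Re (z * cis \<theta>) > c}"

text \<open>Only meaningful as a domain in the plane for intervals \<open>I\<close> of length at most \<open>\<pi>\<close>.\<close>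

definition borel_domain :: "real set \<Rightarrow> (real \<Rightarrow> real) \<Rightarrow> complex set" where
  "borel_domain I \<gamma> = (\<Union>\<theta>\<in>I. half_plane \<theta> (\<gamma> \<theta>))"

text \<open>
  The values on the sector do not depend on the choice: for an open interval \<open>I\<close>
  the sector is connected and has \<open>0\<close> in its closure.
\<close>

definition sector_continuation :: "real set \<Rightarrow> complex fps \<Rightarrow> complex \<Rightarrow> complex" where
  "sector_continuation I F = (SOME f. continues_germ_to f F (open_sector I))"

text \<open>
  The Borel sum at \<open>z \<in> \<D>(I,\<gamma>)\<close> is the common value of the Laplace integrals over all
  directions \<open>\<theta> \<in> I\<close> with \<open>z\<close> in the corresponding half-plane.
\<close>

definition borel_sum :: "real set \<Rightarrow> (real \<Rightarrow> real) \<Rightarrow> complex fps \<Rightarrow> complex \<Rightarrow> complex" where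
  "borel_sum I \<gamma> \<phi> z = (THE w. \<forall>\<theta>\<in>I. z \<in> half_plane \<theta> (\<gamma> \<theta>) \<longrightarrow>
     ((\<lambda>\<xi>. exp (- z * of_real \<xi> * cis \<theta>) *
            sector_continuation I (formal_borel \<phi>) (of_real \<xi> * cis \<theta>) * cis \<theta>)
        has_integral w) {0<..})"

definition coth :: "complex \<Rightarrow> complex" where
  "coth z = cosh z / sinh z"

text \<open>\<open>z powr a\<close> is \<open>exp (a * Ln z)\<close> with the principal branch \<open>Ln\<close> for \<open>z \<noteq> 0\<close>.\<close>

definition stirling_factor :: "complex \<Rightarrow> complex" where
  "stirling_factor z =
     1 / of_real (sqrt (2 * pi)) * z powr (1 / 2 - z) * exp z * Gamma z"

definition imaginary_cuts :: "complex set" where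
  "imaginary_cuts = {2 * of_real pi * \<i> * of_real t | t. t \<ge> 1} \<union>
                    {- (2 * of_real pi * \<i> * of_real t) | t. t \<ge> 1}"

end

theory Submission
  imports Defs "HOL-Complex_Analysis.Complex_Analysis" "HOL-Real_Asymp.Real_Asymp"
begin

text \<open>
  On \<open>Re z > 0\<close> the Laplace transforms of the functions \<open>t\<^sup>k \<mu>(t)\<close>, with \<open>\<mu>\<close> the announced Borel
  transform, are related to the polygamma functions.  The Laplace transform of \<open>t\<^sup>2 \<mu>(t)\<close> satisfies
  the same difference equation as \<open>Polygamma 1 z - 1 / z - 1 / (2 z\<^sup>2)\<close>, and both vanish at \<open>+\<infinity>\<close>, so
  they agree.  Integrating twice gives \<open>ln_Gamma z = (z - 1/2) Ln z - z + \<L>\<mu>(z) + b\<close>: the linear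
  term is excluded by the asymptotics of the digamma function at the integers, and \<open>b\<close> is found from
  the duplication formula.  The identity propagates to the cut plane because the Laplace integrals along
  different rays agree (Cauchy) and are holomorphic.  Divergence holds because a convergent series would
  have an entire Borel transform, whereas \<open>\<mu>\<close> has a pole at \<open>2\<pi>\<i>\<close>.
\<close>

subsection \<open>Laplace transforms\<close>

text \<open>Absolute convergence is demanded for every damping rate \<open>c > 0\<close>, so the
  transform lives on the whole half-plane \<open>Re z > 0\<close> and the class is stable under
  multiplication by \<open>t\<close>. Measurability is included so that integrability can be
  obtained by domination.\<close>

definition laplace_integrable :: "(real \<Rightarrow> complex) \<Rightarrow> bool" where
  "laplace_integrable m \<longleftrightarrow> m \<in> borel_measurable (lebesgue_on {0<..}) \<and>
     (\<forall>c>0. (\<lambda>t. exp (- c * t) * norm (m t)) integrable_on {0<..})"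

definition laplace :: "(real \<Rightarrow> complex) \<Rightarrow> complex \<Rightarrow> complex" where
  "laplace m z = integral {0<..} (\<lambda>t. exp (- z * of_real t) * m t)"

lemma exp_minus_integrable_on_Ioi:
  assumes "(c::real) > 0"
  shows "(\<lambda>t. exp (- c * t)) integrable_on {0<..}"
proof -
  have "(\<lambda>t. exp (- c * t)) integrable_on {0..}"
    using integrable_on_exp_minus_to_infinity[OF assms] .
  moreover have "({0..} - {0<..}) \<union> ({0<..} - {0..}) = {0::real}"
    by auto
  ultimately show ?thesis
    by (metis (no_types, lifting) negligible_sing integrable_spike_set_eq sup_commute)
qed

lemma laplace_integrand_integrable:
  assumes "laplace_integrable m" "Re z > 0"
  shows "(\<lambda>t. exp (- z * of_real t) * m t) absolutely_integrable_on {0<..}"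
proof (rule measurable_bounded_by_integrable_imp_absolutely_integrable)
  have "(\<lambda>t. exp (- z * of_real t)) \<in> borel_measurable (lebesgue_on {0<..})"
    by (intro continuous_imp_measurable_on_sets_lebesgue continuous_intros) auto
  then show "(\<lambda>t. exp (- z * of_real t) * m t) \<in> borel_measurable (lebesgue_on {0<..})"
    using assms(1) unfolding laplace_integrable_def by (intro borel_measurable_times) auto
  show "(\<lambda>t. exp (- Re z * t) * norm (m t)) integrable_on {0<..}"
    using assms unfolding laplace_integrable_def by blast
qed (auto simp: norm_mult)

lemma laplace_has_integral:
  assumes "laplace_integrable m" "Re z > 0"
  shows "((\<lambda>t. exp (- z * of_real t) * m t) has_integral laplace m z) {0<..}"
  using laplace_integrand_integrable[OF assms] unfolding laplace_def absolutely_integrable_on_def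
  by blast

lemma laplace_integrable_bounded:
  assumes "continuous_on {0<..} m" "\<And>t. t > 0 \<Longrightarrow> norm (m t) \<le> C"
  shows "laplace_integrable m"
  unfolding laplace_integrable_def
proof (intro conjI allI impI)
  show "m \<in> borel_measurable (lebesgue_on {0<..})"
    by (intro continuous_imp_measurable_on_sets_lebesgue assms) auto
  fix c :: real assume "c > 0"
  then have "(\<lambda>t. exp (- c * t) * C) integrable_on {0<..}"
    using exp_minus_integrable_on_Ioi by (intro integrable_on_mult_left) auto
  moreover have "(\<lambda>t. exp (- c * t) * norm (m t)) \<in> borel_measurable (lebesgue_on {0<..})"
    by (intro continuous_imp_measurable_on_sets_lebesgue continuous_intros assms) auto
  ultimately have "(\<lambda>t. exp (- c * t) * norm (m t)) absolutely_integrable_on {0<..}"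
    using assms(2) by (intro measurable_bounded_by_integrable_imp_absolutely_integrable) auto
  then show "(\<lambda>t. exp (- c * t) * norm (m t)) integrable_on {0<..}"
    by (simp add: absolutely_integrable_on_def)
qed

text \<open>Half of the exponential absorbs the factor \<open>t\<close>, since
  \<open>t \<le> 2 / c * exp (c / 2 * t)\<close>. This is what allows repeated differentiation of a
  Laplace transform.\<close>

lemma laplace_integrable_mult_ident:
  assumes "laplace_integrable m"
  shows "laplace_integrable (\<lambda>t. of_real t * m t)"
  unfolding laplace_integrable_def
proof (intro conjI allI impI)
  have m: "m \<in> borel_measurable (lebesgue_on {0<..})"
    using assms by (simp add: laplace_integrable_def)
  have c: "(\<lambda>t. of_real t :: complex) \<in> borel_measurable (lebesgue_on {0<..})"
    by (intro continuous_imp_measurable_on_sets_lebesgue continuous_intros) auto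
  show *: "(\<lambda>t. of_real t * m t) \<in> borel_measurable (lebesgue_on {0<..})"
    using m c by (intro borel_measurable_times) auto
  fix c :: real assume c: "c > 0"
  have "(\<lambda>t. 2 / c * (exp (- (c / 2) * t) * norm (m t))) integrable_on {0<..}"
    using assms c half_gt_zero[OF c] unfolding laplace_integrable_def
    by (intro integrable_on_mult_right) blast
  moreover have "(\<lambda>t. exp (- c * t)) \<in> borel_measurable (lebesgue_on {0<..})"
    by (intro continuous_imp_measurable_on_sets_lebesgue continuous_intros) auto
  then have "(\<lambda>t. exp (- c * t) * norm (of_real t * m t)) \<in> borel_measurable (lebesgue_on {0<..})"
    by (rule borel_measurable_times[OF _ measurable_compose[OF * borel_measurable_norm]])
  moreover have "norm (exp (- c * t) * norm (of_real t * m t)) \<le> 2 / c * (exp (- (c / 2) * t) * norm (m t))"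
    if "t > 0" for t
  proof -
    have "c / 2 * t \<le> exp (c / 2 * t)"
      using exp_ge_add_one_self[of "c / 2 * t"] by linarith
    then have "exp (- c * t) * t \<le> exp (- c * t) * (2 / c * exp (c / 2 * t))"
      using c by (intro mult_left_mono) (auto simp: field_simps)
    also have "\<dots> = 2 / c * exp (- (c / 2) * t)"
      by (simp add: exp_add[symmetric] field_simps)
    finally have "exp (- c * t) * t * norm (m t) \<le> 2 / c * exp (- (c / 2) * t) * norm (m t)"
      by (intro mult_right_mono) auto
    then show ?thesis using that by (simp add: norm_mult mult_ac)
  qed
  ultimately have "(\<lambda>t. exp (- c * t) * norm (of_real t * m t)) absolutely_integrable_on {0<..}"
    by (intro measurable_bounded_by_integrable_imp_absolutely_integrable) auto
  then show "(\<lambda>t. exp (- c * t) * norm (of_real t * m t)) integrable_on {0<..}"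
    by (simp add: absolutely_integrable_on_def)
qed

lemma norm_exp_minus_one_minus_self_le:
  fixes w :: complex
  shows "norm (exp w - 1 - w) \<le> (norm w)\<^sup>2 * exp (norm w)"
  using Taylor_exp_field[of w 1] by (simp add: power2_eq_square algebra_simps)

text \<open>Differentiation under the integral sign by a direct estimate. The second-order remainder
  of \<open>exp (- h * t)\<close> is at most \<open>|h|^2 t^2 exp (|h| t)\<close>; restricting to
  \<open>|h| < c = Re z / 2\<close> leaves decay \<open>exp (- c * t)\<close>, so the error of the
  difference quotient is at most \<open>norm h * A\<close> with \<open>A\<close> independent of
  \<open>h\<close>.\<close>

lemma has_field_derivative_laplace:
  assumes m: "laplace_integrable m" and z: "Re z > 0"
  shows "(laplace m has_field_derivative - laplace (\<lambda>t. of_real t * m t) z) (at z)"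
proof -
  define c where "c = Re z / 2"
  define A where "A = integral {0<..} (\<lambda>t. exp (- c * t) * norm (of_real t * (of_real t * m t)))"
  have c: "c > 0" using z by (simp add: c_def)
  have m1: "laplace_integrable (\<lambda>t. of_real t * m t)"
    and m2: "laplace_integrable (\<lambda>t. of_real t * (of_real t * m t))"
    using m by (auto intro: laplace_integrable_mult_ident)
  have int: "(\<lambda>t. exp (- c * t) * norm (of_real t * (of_real t * m t))) integrable_on {0<..}"
    using m2 c unfolding laplace_integrable_def by blast
  have A: "A \<ge> 0" unfolding A_def by (rule integral_nonneg[OF int]) auto
  have *: "norm ((laplace m (z + h) - laplace m z) / h - (- laplace (\<lambda>t. of_real t * m t) z)) \<le> norm h * A"
    if h: "h \<noteq> 0" "norm h < c" for h
  proof -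
    have zh: "Re (z + h) > 0" using h(2) abs_Re_le_cmod[of h] z by (simp add: c_def)
    have 1: "((\<lambda>t. exp (- (z + h) * of_real t) * m t - exp (- z * of_real t) * m t +
               h * (exp (- z * of_real t) * (of_real t * m t))) has_integral
             laplace m (z + h) - laplace m z + h * laplace (\<lambda>t. of_real t * m t) z) {0<..}"
      using laplace_has_integral[OF m zh] laplace_has_integral[OF m z] laplace_has_integral[OF m1 z]
      by (intro has_integral_add has_integral_diff has_integral_mult_right)
    have 2: "norm (exp (- (z + h) * of_real t) * m t - exp (- z * of_real t) * m t +
               h * (exp (- z * of_real t) * (of_real t * m t)))
            \<le> (norm h)\<^sup>2 * (exp (- c * t) * norm (of_real t * (of_real t * m t)))" (is "norm ?l \<le> ?r")
      if t: "t \<in> {0<..}" for t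
    proof -
      have "?l = exp (- z * of_real t) * (exp (- h * of_real t) - 1 - (- h * of_real t)) * m t"
        by (simp add: algebra_simps exp_add exp_diff exp_minus divide_simps)
      also have "norm \<dots> = exp (- Re z * t) * norm (exp (- h * of_real t) - 1 - (- h * of_real t)) * norm (m t)"
        by (simp add: norm_mult)
      also have "\<dots> \<le> exp (- Re z * t) * ((norm (- h * of_real t))\<^sup>2 * exp (norm (- h * of_real t))) * norm (m t)"
        by (intro mult_right_mono mult_left_mono norm_exp_minus_one_minus_self_le) auto
      also have "\<dots> = (exp (- Re z * t) * exp (norm h * t)) * (norm h)\<^sup>2 * (t * t * norm (m t))"
        using t by (simp add: norm_mult power2_eq_square mult_ac)
      also have "exp (- Re z * t) * exp (norm h * t) = exp ((norm h - 2 * c) * t)"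
        by (simp add: exp_add[symmetric] c_def algebra_simps)
      also have "exp ((norm h - 2 * c) * t) * (norm h)\<^sup>2 * (t * t * norm (m t)) \<le>
        exp (- c * t) * (norm h)\<^sup>2 * (t * t * norm (m t))"
      proof (intro mult_right_mono)
        have "(norm h - 2 * c) * t \<le> - c * t"
          using t h by (intro mult_right_mono) auto
        then show "exp ((norm h - 2 * c) * t) \<le> exp (- c * t)" by simp
      qed (use t in auto)
      finally show ?thesis using t by (simp add: norm_mult mult_ac)
    qed
    have "norm (laplace m (z + h) - laplace m z + h * laplace (\<lambda>t. of_real t * m t) z) \<le>
          integral {0<..} (\<lambda>t. (norm h)\<^sup>2 * (exp (- c * t) * norm (of_real t * (of_real t * m t))))"
      using integral_norm_bound_integral[OF has_integral_integrable[OF 1] _ 2]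
        integrable_on_mult_right[OF int, of "(norm h)\<^sup>2"] integral_unique[OF 1] by simp
    also have "\<dots> = (norm h)\<^sup>2 * A" unfolding A_def by simp
    finally have "norm (laplace m (z + h) - laplace m z + h * laplace (\<lambda>t. of_real t * m t) z) / norm h \<le> norm h * A"
      using h by (simp add: field_simps power2_eq_square)
    also have "norm (laplace m (z + h) - laplace m z + h * laplace (\<lambda>t. of_real t * m t) z) / norm h =
       norm ((laplace m (z + h) - laplace m z) / h - (- laplace (\<lambda>t. of_real t * m t) z))"
      using h by (subst norm_divide[symmetric]) (simp add: field_simps)
    finally show ?thesis .
  qed
  show ?thesis
    unfolding DERIV_def
  proof (subst LIM_zero_iff[symmetric], rule Lim_null_comparison)
    show "\<forall>\<^sub>F h in at 0. norm ((laplace m (z + h) - laplace m z) / h - (- laplace (\<lambda>t. of_real t * m t) z)) \<le> norm h * A"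
      unfolding eventually_at using * c by (auto intro!: exI[of _ c] simp: dist_norm)
    show "((\<lambda>h. norm h * A) \<longlongrightarrow> 0) (at 0)"
      by (auto intro!: tendsto_eq_intros)
  qed
qed

lemma holomorphic_on_laplace:
  assumes "laplace_integrable m"
  shows "laplace m holomorphic_on {z. Re z > 0}"
  by (rule holomorphic_onI, rule field_differentiable_at_within)
     (use has_field_derivative_laplace[OF assms] in \<open>unfold field_differentiable_def, blast\<close>)

text \<open>Dominated convergence: moving right from \<open>z\<close> only shrinks the integrand, so
  the one at \<open>z\<close> itself is the majorant.\<close>

lemma laplace_LIMSEQ_0:
  assumes m: "laplace_integrable m" and z: "Re z > 0"
    and x: "filterlim x at_top sequentially" "\<And>n. x n \<ge> 0"
  shows "(\<lambda>n. laplace m (z + of_real (x n))) \<longlonglongrightarrow> 0"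
proof -
  have "(\<lambda>n. integral {0<..} (\<lambda>t. exp (- (z + of_real (x n)) * of_real t) * m t)) \<longlonglongrightarrow> integral {0<..} (\<lambda>t::real. 0::complex)"
  proof (rule dominated_convergence)
    show "(\<lambda>t. exp (- (z + of_real (x n)) * of_real t) * m t) integrable_on {0<..}" for n
      using laplace_has_integral[OF m, of "z + of_real (x n)"] z x(2)[of n]
      by (auto simp: integrable_on_def)
    show "(\<lambda>t. exp (- Re z * t) * norm (m t)) integrable_on {0<..}"
      using m z unfolding laplace_integrable_def by blast
    show "norm (exp (- (z + of_real (x n)) * of_real t) * m t) \<le> exp (- Re z * t) * norm (m t)"
      if "t \<in> {0<..}" for n t
    proof -
      have "(- Re z - x n) * t \<le> - Re z * t"
        using that x(2)[of n] by (intro mult_right_mono) auto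
      then show ?thesis unfolding norm_mult by (intro mult_right_mono) auto
    qed
    show "(\<lambda>n. exp (- (z + of_real (x n)) * of_real t) * m t) \<longlonglongrightarrow> 0" if "t \<in> {0<..}" for t
    proof (rule tendsto_norm_zero_cancel)
      have "(\<lambda>n. exp (- (Re z * t) - t * x n) * norm (m t)) \<longlonglongrightarrow> 0"
      proof (intro tendsto_mult_left_zero filterlim_compose[OF exp_at_bot])
        have "filterlim (\<lambda>n. t * x n) at_top sequentially"
          using that x(1) by (intro filterlim_tendsto_pos_mult_at_top[OF tendsto_const]) auto
        then have "filterlim (\<lambda>n. - (t * x n)) at_bot sequentially"
          by (simp add: filterlim_uminus_at_bot)
        then show "LIM n sequentially. - (Re z * t) - t * x n :> at_bot"
          using filterlim_tendsto_add_at_bot_iff[OF tendsto_const[of "- (Re z * t)"],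
              of "\<lambda>n. - (t * x n)" sequentially] by simp
      qed
      then show "(\<lambda>n. norm (exp (- (z + of_real (x n)) * of_real t) * m t)) \<longlonglongrightarrow> 0"
        by (simp add: norm_mult algebra_simps)
    qed
  qed
  then show ?thesis by (simp add: laplace_def)
qed

text \<open>Passing to compact intervals makes the fundamental theorem of calculus applicable to
  Laplace integrals. Including the endpoint \<open>0\<close> changes only a null set.\<close>

lemma tendsto_integral_Ioi:
  fixes g :: "real \<Rightarrow> complex"
  assumes "g absolutely_integrable_on {0<..}"
  shows "(\<lambda>n. integral {0..real n} g) \<longlonglongrightarrow> integral {0<..} g"
proof -
  have eq: "{..real n} \<inter> {0<..} = {0<..real n}" for n by auto
  have g: "g integrable_on {0<..}" "(\<lambda>t. norm (g t)) integrable_on {0<..}"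
    using assms by (auto simp: absolutely_integrable_on_def)
  have *: "g integrable_on {0<..real n}" for n
    by (intro set_lebesgue_integral_eq_integral(1) set_integrable_subset[OF assms]) auto
  have "(\<lambda>n. integral {0<..} (\<lambda>t. if t \<in> {..real n} then g t else 0)) \<longlonglongrightarrow> integral {0<..} g"
  proof (rule dominated_convergence)
    show "(\<lambda>t. if t \<in> {..real n} then g t else 0) integrable_on {0<..}" for n
      unfolding integrable_restrict_Int eq by (rule *)
    show "(\<lambda>n. if t \<in> {..real n} then g t else 0) \<longlonglongrightarrow> g t" if "t \<in> {0<..}" for t
    proof (rule tendsto_eventually)
      show "\<forall>\<^sub>F n in sequentially. (if t \<in> {..real n} then g t else 0) = g t"
        using eventually_ge_at_top[of "nat \<lceil>t\<rceil>"] by eventually_elim (auto simp: nat_le_iff ceiling_le_iff)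
    qed
  qed (use g in auto)
  also have "(\<lambda>n. integral {0<..} (\<lambda>t. if t \<in> {..real n} then g t else 0)) = (\<lambda>n. integral {0..real n} g)"
    unfolding integral_restrict_Int eq
    by (intro ext integral_spike_set) (auto intro: negligible_subset[of "{0}"])
  finally show ?thesis .
qed

lemma laplace_one:
  assumes z: "Re z > 0"
  shows "laplace (\<lambda>_. 1) z = 1 / z"
proof -
  have z0: "z \<noteq> 0" using z by auto
  have "laplace_integrable (\<lambda>_. 1)"
    by (rule laplace_integrable_bounded[of _ 1]) auto
  from tendsto_integral_Ioi[OF laplace_integrand_integrable[OF this z]]
  have "(\<lambda>n. integral {0..real n} (\<lambda>t. exp (- z * of_real t))) \<longlonglongrightarrow> laplace (\<lambda>_. 1) z"
    by (simp add: laplace_def)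
  moreover have "integral {0..real n} (\<lambda>t. exp (- z * of_real t)) = (1 - exp (- z * of_real (real n))) / z" for n
  proof -
    have "((\<lambda>t. exp (- z * of_real t)) has_integral
            - exp (- z * of_real (real n)) / z - - exp (- z * of_real 0) / z) {0..real n}"
      by (rule fundamental_theorem_of_calculus)
         (use z0 in \<open>auto intro!: derivative_eq_intros has_vector_derivative_real_field\<close>)
    then show ?thesis by (simp add: integral_unique diff_divide_distrib)
  qed
  moreover have "(\<lambda>n. (1 - exp (- z * of_real (real n))) / z) \<longlonglongrightarrow> (1 - 0) / z"
  proof (intro tendsto_intros z0, rule tendsto_norm_zero_cancel)
    have "(\<lambda>n. exp (- Re z * real n)) \<longlonglongrightarrow> 0" using z by real_asymp
    then show "(\<lambda>n. norm (exp (- z * of_real (real n)))) \<longlonglongrightarrow> 0" by simp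
  qed
  ultimately show ?thesis using LIMSEQ_unique by fastforce
qed

text \<open>Differentiating \<open>laplace_one\<close> in \<open>z\<close> brings down the factor
  \<open>- t\<close>.\<close>

lemma laplace_ident:
  assumes "Re z > 0"
  shows "laplace of_real z = 1 / z\<^sup>2"
proof -
  have i: "laplace_integrable (\<lambda>_. 1)"
    by (rule laplace_integrable_bounded[of _ 1]) auto
  have "((\<lambda>z. 1 / z) has_field_derivative - laplace of_real z) (at z)"
  proof (rule has_field_derivative_transform_within_open)
    show "(laplace (\<lambda>_. 1) has_field_derivative - laplace of_real z) (at z)"
      using has_field_derivative_laplace[OF i assms] by simp
    show "open {z. Re z > 0}" by (rule open_halfspace_Re_gt)
  qed (use assms laplace_one in auto)
  moreover have "((\<lambda>z. 1 / z) has_field_derivative - (1 / z\<^sup>2)) (at z)"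
    using assms by (auto intro!: derivative_eq_intros simp: power2_eq_square)
  ultimately show ?thesis using DERIV_unique by fastforce
qed

subsection \<open>Binet's formula\<close>

lemma Re_pos_not_nonpos_Reals:
  assumes "Re z > 0"
  shows "z \<notin> \<real>\<^sub>\<le>\<^sub>0" "z \<notin> \<int>\<^sub>\<le>\<^sub>0" "z \<noteq> 0"
  using assms nonpos_Ints_subset_nonpos_Reals by (auto simp: complex_nonpos_Reals_iff)

text \<open>\<open>Polygamma 1 z\<close> is the sum of \<open>1 / (z + k)^2\<close> over all
  \<open>k\<close>, so its value at \<open>z + n\<close> is a tail of that convergent
  series.\<close>

lemma Polygamma_1_LIMSEQ_0:
  fixes z :: complex
  assumes "Re z > 0"
  shows "(\<lambda>n. Polygamma 1 (z + of_nat n)) \<longlonglongrightarrow> 0"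
proof -
  have *: "summable (\<lambda>k. inverse ((z + of_nat k)\<^sup>2))"
    using Polygamma_converges'[of z 2] Re_pos_not_nonpos_Reals(3)[OF assms] by simp
  have "(\<lambda>n. \<Sum>k. inverse ((z + of_nat (k + n))\<^sup>2)) \<longlonglongrightarrow> 0"
    using suminf_exist_split2[OF *] .
  then show ?thesis
    by (simp add: Polygamma_def numeral_2_eq_2 add_ac)
qed

text \<open>Both sides have the same forward difference and tend to \<open>0\<close> along \<open>z + \<nat>\<close>.\<close>

lemma Polygamma_1_eq_laplace:
  fixes k :: "real \<Rightarrow> complex"
  assumes k: "laplace_integrable k"
    and keq: "\<And>t. t > 0 \<Longrightarrow> k t * (1 - exp (- of_real t)) =
                of_real t / 2 - 1 + (of_real t / 2 + 1) * exp (- of_real t)"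
    and z: "Re z > 0"
  shows "laplace k z = Polygamma 1 z - 1 / z - 1 / (2 * z\<^sup>2)"
proof -
  define P where "P = (\<lambda>z::complex. Polygamma 1 z - 1 / z - 1 / (2 * z\<^sup>2))"
  have one: "laplace_integrable (\<lambda>_. 1)"
    by (rule laplace_integrable_bounded[of _ 1]) auto
  have ident: "laplace_integrable of_real"
    using laplace_integrable_mult_ident[OF one] by simp
  \<comment> \<open>Multiplied by \<open>exp (- z * of_real t)\<close>, the hypothesis
    \<open>keq\<close> expresses the difference of the two integrands through the integrands for
    \<open>1\<close> and \<open>t\<close> at \<open>z\<close> and \<open>z + 1\<close>, whose
    transforms are known.\<close>
  have step: "laplace k z - laplace k (z + 1) = P z - P (z + 1)" if z: "Re z > 0" for z
  proof -
    have z1: "Re (z + 1) > 0" using z by simp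
    have "((\<lambda>t. exp (- z * of_real t) * k t - exp (- (z + 1) * of_real t) * k t)
             has_integral laplace k z - laplace k (z + 1)) {0<..}"
      by (intro has_integral_diff laplace_has_integral k z z1)
    moreover have "((\<lambda>t. 1 / 2 * (exp (- z * of_real t) * of_real t) - exp (- z * of_real t) * 1 +
                        (1 / 2 * (exp (- (z + 1) * of_real t) * of_real t) + exp (- (z + 1) * of_real t) * 1))
             has_integral 1 / 2 * laplace of_real z - laplace (\<lambda>_. 1) z +
                          (1 / 2 * laplace of_real (z + 1) + laplace (\<lambda>_. 1) (z + 1))) {0<..}"
      by (intro has_integral_add has_integral_diff has_integral_mult_right laplace_has_integral
            one ident z z1)
    moreover have "exp (- z * of_real t) * k t - exp (- (z + 1) * of_real t) * k t =
        1 / 2 * (exp (- z * of_real t) * of_real t) - exp (- z * of_real t) * 1 +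
        (1 / 2 * (exp (- (z + 1) * of_real t) * of_real t) + exp (- (z + 1) * of_real t) * 1)"
      if "t \<in> {0<..}" for t
    proof -
      have e: "exp (- (z + 1) * of_real t) = exp (- z * of_real t) * exp (- of_real t)"
        by (simp add: exp_add[symmetric] algebra_simps)
      have "exp (- z * of_real t) * k t - exp (- (z + 1) * of_real t) * k t =
            exp (- z * of_real t) * (k t * (1 - exp (- of_real t)))"
        unfolding e by (simp add: algebra_simps)
      also have "\<dots> = exp (- z * of_real t) *
                     (of_real t / 2 - 1 + (of_real t / 2 + 1) * exp (- of_real t))"
        using that by (simp only: keq greaterThan_iff)
      finally show ?thesis unfolding e by (simp add: algebra_simps)
    qed
    ultimately have "laplace k z - laplace k (z + 1) =
        1 / 2 * laplace of_real z - laplace (\<lambda>_. 1) z +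
        (1 / 2 * laplace of_real (z + 1) + laplace (\<lambda>_. 1) (z + 1))"
      by (metis (no_types, lifting) has_integral_cong has_integral_unique)
    also have "\<dots> = 1 / (2 * z\<^sup>2) - 1 / z + 1 / (2 * (z + 1)\<^sup>2) + 1 / (z + 1)"
      using z z1 by (simp add: laplace_ident laplace_one)
    also have "\<dots> = P z - P (z + 1)"
    proof -
      \<comment> \<open>The term \<open>1 / z^2\<close> of the recurrence is written as two halves
        to match the term \<open>1 / (2 * z^2)\<close> in \<open>P\<close>.\<close>
      have *: "Polygamma 1 (z + 1) = Polygamma 1 z - 1 / (2 * z\<^sup>2) - 1 / (2 * z\<^sup>2)"
        using Polygamma_plus1[OF Re_pos_not_nonpos_Reals(3)[OF z], of 1] by (simp add: numeral_2_eq_2)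
      show ?thesis unfolding P_def * by algebra
    qed
    finally show ?thesis .
  qed
  have const: "laplace k (z + of_nat n) - P (z + of_nat n) = laplace k z - P z" for n
  proof (induction n)
    case (Suc n)
    have "z + of_nat (Suc n) = (z + of_nat n) + 1" by simp
    moreover have "laplace k (z + of_nat n) - laplace k (z + of_nat n + 1) =
                   P (z + of_nat n) - P (z + of_nat n + 1)"
      using z by (intro step) simp
    ultimately show ?case using Suc.IH by (simp only:) algebra
  qed simp
  define u where "u = (\<lambda>n. 1 / (z + of_nat n))"
  have u: "u \<longlonglongrightarrow> 0" unfolding u_def
    by (intro tendsto_divide_0[OF tendsto_const] tendsto_add_filterlim_at_infinity[OF tendsto_const]
          tendsto_of_nat)
  have "(\<lambda>n. Polygamma 1 (z + of_nat n) - u n - 1 / 2 * (u n)\<^sup>2) \<longlonglongrightarrow> 0 - 0 - 1 / 2 * 0\<^sup>2"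
    by (intro tendsto_intros Polygamma_1_LIMSEQ_0 z u)
  then have "(\<lambda>n. P (z + of_nat n)) \<longlonglongrightarrow> 0 - 0 - 1 / 2 * 0\<^sup>2"
    by (simp add: P_def u_def power_divide)
  moreover have "(\<lambda>n. laplace k (z + of_nat n)) \<longlonglongrightarrow> 0"
    using laplace_LIMSEQ_0[OF k z filterlim_real_sequentially] by simp
  ultimately have "(\<lambda>n. laplace k (z + of_nat n) - P (z + of_nat n)) \<longlonglongrightarrow> 0 - (0 - 0 - 1 / 2 * 0\<^sup>2)"
    by (intro tendsto_diff)
  then have "laplace k z - P z = 0"
    unfolding const by (simp add: LIMSEQ_const_iff)
  then show ?thesis by (simp add: P_def)
qed

text \<open>The difference \<open>f\<close> of the two sides has vanishing second derivative, by
  \<open>Polygamma_1_eq_laplace\<close> for \<open>t^2 m(t)\<close>. Its derivative is therefore a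
  constant \<open>a\<close>, and the limit along the positive integers gives
  \<open>a = 0\<close>.\<close>

lemma ln_Gamma_eq_laplace_plus_const:
  fixes m :: "real \<Rightarrow> complex"
  assumes m: "laplace_integrable m"
    and meq: "\<And>t. t > 0 \<Longrightarrow> of_real t * (of_real t * m t) * (1 - exp (- of_real t)) =
                of_real t / 2 - 1 + (of_real t / 2 + 1) * exp (- of_real t)"
  obtains b where "\<And>z. Re z > 0 \<Longrightarrow> ln_Gamma z = (z - 1 / 2) * Ln z - z + laplace m z + b"
proof -
  define H where "H = {z::complex. Re z > 0}"
  have H: "open H" "convex H" "connected H"
    by (auto simp: H_def open_halfspace_Re_gt convex_halfspace_Re_gt convex_connected)
  note nz = Re_pos_not_nonpos_Reals
  have m1: "laplace_integrable (\<lambda>t. of_real t * m t)"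
    and m2: "laplace_integrable (\<lambda>t. of_real t * (of_real t * m t))"
    using m by (auto intro: laplace_integrable_mult_ident)
  define f where "f = (\<lambda>z. ln_Gamma z - ((z - 1 / 2) * Ln z - z + laplace m z))"
  define f' where "f' = (\<lambda>z. Digamma z - (Ln z - 1 / (2 * z)) + laplace (\<lambda>t. of_real t * m t) z)"
  have f': "(f has_field_derivative f' z) (at z)" if "z \<in> H" for z
    unfolding f_def f'_def using nz[of z] that
    by (auto intro!: derivative_eq_intros has_field_derivative_laplace[OF m]
             simp: H_def field_simps)
  have f'': "(f' has_field_derivative 0) (at z)" if "z \<in> H" for z
  proof -
    have "(f' has_field_derivative (Polygamma 1 z - 1 / z - 1 / (2 * z\<^sup>2) -
             laplace (\<lambda>t. of_real t * (of_real t * m t)) z)) (at z)"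
      unfolding f'_def using nz[of z] that
      by (auto intro!: derivative_eq_intros has_field_derivative_laplace[OF m1]
               simp: H_def field_simps power2_eq_square)
    then show ?thesis
      using Polygamma_1_eq_laplace[OF m2 meq, of z] that by (simp add: H_def)
  qed
  have "\<exists>a. \<forall>z\<in>H. f' z = a"
    by (rule has_field_derivative_zero_constant[OF H(2)])
       (use f'' in \<open>blast intro: has_field_derivative_at_within\<close>)
  then obtain a where a: "\<And>z. z \<in> H \<Longrightarrow> f' z = a" by blast
  have "(\<lambda>n. f' (of_nat (Suc n))) \<longlonglongrightarrow> 0"
  proof -
    have "(\<lambda>n. of_real (harm n - euler_mascheroni - (ln (real (Suc n)) - 1 / (2 * real (Suc n)))) +
             laplace (\<lambda>t. of_real t * m t) (1 + of_real (real n))) \<longlonglongrightarrow> of_real 0 + 0"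
    proof (intro tendsto_intros laplace_LIMSEQ_0[OF m1] filterlim_real_sequentially)
      \<comment> \<open>The digamma value at \<open>n + 1\<close> is
        \<open>harm n - euler_mascheroni\<close>. Inserting \<open>ln (real n)\<close> isolates the
        limit that defines the Euler-Mascheroni constant and leaves an elementary null
        sequence.\<close>
      have "(\<lambda>n. harm n - ln (real n) - euler_mascheroni +
                 (ln (real n) - ln (real (Suc n)) + 1 / (2 * real (Suc n))))
            \<longlonglongrightarrow> euler_mascheroni - euler_mascheroni + (0 :: real)"
      proof (intro tendsto_add tendsto_diff euler_mascheroni_LIMSEQ tendsto_const)
        show "(\<lambda>n. ln (real n) - ln (real (Suc n)) + 1 / (2 * real (Suc n))) \<longlonglongrightarrow> 0"
          by real_asymp
      qed
      then show "(\<lambda>n. harm n - euler_mascheroni - (ln (real (Suc n)) - 1 / (2 * real (Suc n)))) \<longlonglongrightarrow> 0"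
        by (simp add: algebra_simps)
    qed auto
    also have "(\<lambda>n. of_real (harm n - euler_mascheroni - (ln (real (Suc n)) - 1 / (2 * real (Suc n)))) +
             laplace (\<lambda>t. of_real t * m t) (1 + of_real (real n))) = (\<lambda>n. f' (of_nat (Suc n)))"
    proof
      fix n
      have "Ln (of_nat (Suc n)) = of_real (ln (real (Suc n)))"
        by (subst of_real_of_nat_eq[symmetric], subst Ln_of_real) auto
      moreover have "harm n = (of_real (harm n) :: complex)"
        "euler_mascheroni = (of_real euler_mascheroni :: complex)"
        by (auto simp: of_real_harm)
      ultimately show "of_real (harm n - euler_mascheroni - (ln (real (Suc n)) - 1 / (2 * real (Suc n)))) +
             laplace (\<lambda>t. of_real t * m t) (1 + of_real (real n)) = f' (of_nat (Suc n))"
        unfolding f'_def Digamma_of_nat by (simp add: add.commute)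
    qed
    finally show ?thesis by simp
  qed
  moreover have "f' (of_nat (Suc n)) = a" for n by (rule a) (simp add: H_def)
  ultimately have "a = 0" by (simp add: LIMSEQ_const_iff)
  have "\<exists>b. \<forall>z\<in>H. f z = b"
    by (rule has_field_derivative_zero_constant[OF H(2)])
       (use f' a \<open>a = 0\<close> in \<open>metis has_field_derivative_at_within\<close>)
  then obtain b where "\<And>z. z \<in> H \<Longrightarrow> f z = b" by blast
  then show ?thesis
    by (intro that[of b]) (auto simp: f_def H_def algebra_simps)
qed

text \<open>The constant is determined by comparing both sides of Legendre's duplication formula at infinity.\<close>

lemma Gamma_eq_exp_laplace:
  fixes m :: "real \<Rightarrow> complex"
  assumes m: "laplace_integrable m"
    and meq: "\<And>t. t > 0 \<Longrightarrow> of_real t * (of_real t * m t) * (1 - exp (- of_real t)) =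
                of_real t / 2 - 1 + (of_real t / 2 + 1) * exp (- of_real t)"
    and z: "Re z > 0"
  shows "Gamma z = of_real (sqrt (2 * pi)) * exp ((z - 1 / 2) * Ln z - z + laplace m z)"
proof -
  obtain b where b: "\<And>z. Re z > 0 \<Longrightarrow> ln_Gamma z = (z - 1 / 2) * Ln z - z + laplace m z + b"
    by (rule ln_Gamma_eq_laplace_plus_const[OF m meq]) auto
  \<comment> \<open>The elementary factor \<open>x^(x - 1/2) e^(-x)\<close> of Stirling's formula,
    kept real so that the later limit is one of real functions.\<close>
  define E where "E = (\<lambda>x::real. exp ((x - 1 / 2) * ln x - x))"
  have G: "Gamma z = exp b * exp ((z - 1 / 2) * Ln z - z + laplace m z)" if "Re z > 0" for z
    using Gamma_complex_altdef[of z] Re_pos_not_nonpos_Reals[OF that] b[OF that]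
    by (simp add: exp_add)
  have Gr: "Gamma (of_real x) = exp b * of_real (E x) * exp (laplace m (of_real x))" if "x > 0" for x
  proof -
    have "Gamma (of_real x) = exp b * exp (of_real ((x - 1 / 2) * ln x - x)) * exp (laplace m (of_real x))"
      using that by (simp add: G Ln_of_real exp_add)
    then show ?thesis by (simp only: E_def exp_of_real)
  qed
  \<comment> \<open>In the duplication formula at \<open>x = n + 1\<close> the left side carries
    \<open>exp b\<close> twice and the right side once. Solving for one copy leaves this elementary
    quotient \<open>q n\<close> times a factor built from \<open>J\<close>, which tends to
    1.\<close>
  define q where "q = (\<lambda>n. exp ((1 - 2 * (real n + 1)) * ln 2) * sqrt pi * E (2 * (real n + 1)) /
                           (E (real n + 1) * E (real n + 1 + 1 / 2)))"
  define J where "J = (\<lambda>x. laplace m (of_real x))"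
  have eq: "exp b = of_real (q n) * exp (J (2 * (real n + 1)) - J (real n + 1) - J (real n + 1 + 1 / 2))" for n
  proof -
    define x where "x = real n + 1"
    have x: "x > 0" by (simp add: x_def)
    have E: "E y \<noteq> 0" for y by (simp add: E_def)
    have xx: "of_real x \<notin> (\<int>\<^sub>\<le>\<^sub>0 :: complex set)" "of_real x + 1 / 2 \<notin> (\<int>\<^sub>\<le>\<^sub>0 :: complex set)"
      using x by (auto intro!: Re_pos_not_nonpos_Reals)
    have "Gamma (of_real x) * Gamma (of_real (x + 1 / 2)) =
          of_real (exp ((1 - 2 * x) * ln 2) * sqrt pi) * (Gamma (of_real (2 * x)) :: complex)"
      using Gamma_legendre_duplication[OF xx] by (simp add: exp_of_real[symmetric])
    then have "exp b * (exp b * of_real (E x * E (x + 1 / 2)) * exp (J x + J (x + 1 / 2))) =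
               exp b * (of_real (exp ((1 - 2 * x) * ln 2) * sqrt pi * E (2 * x)) * exp (J (2 * x)))"
      using x by (simp only: Gr J_def) (simp add: exp_add mult_ac)
    then have "exp b * of_real (E x * E (x + 1 / 2)) * exp (J x + J (x + 1 / 2)) =
               of_real (exp ((1 - 2 * x) * ln 2) * sqrt pi * E (2 * x)) * exp (J (2 * x))"
      by simp
    then show ?thesis
      unfolding q_def x_def[symmetric] using E
      by (simp add: exp_diff exp_add field_simps)
  qed
  \<comment> \<open>\<open>laplace_LIMSEQ_0\<close> needs a base point in the open half-plane;
    \<open>1\<close> is used, hence the shift by one.\<close>
  have Jlim: "(\<lambda>n. J (x n)) \<longlonglongrightarrow> 0" if "filterlim (\<lambda>n. x n - 1) at_top sequentially" "\<And>n. x n \<ge> 1" for x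
    using laplace_LIMSEQ_0[OF m, of 1 "\<lambda>n. x n - 1"] that by (simp add: J_def)
  have "(\<lambda>n. of_real (q n) * exp (J (2 * (real n + 1)) - J (real n + 1) - J (real n + 1 + 1 / 2)))
          \<longlonglongrightarrow> of_real (sqrt (2 * pi)) * exp (0 - 0 - 0)"
  proof (intro tendsto_intros Jlim)
    \<comment> \<open>All powers are collected in a single exponent, whose divergent terms cancel
      and whose limit is \<open>ln 2 / 2\<close>.\<close>
    have qeq: "q n = sqrt pi * exp ((1 - 2 * (real n + 1)) * ln 2 + ((2 * (real n + 1) - 1 / 2) * ln (2 * (real n + 1)) - 2 * (real n + 1)) -
                 ((real n + 1 - 1 / 2) * ln (real n + 1) - (real n + 1)) -
                 ((real n + 1 + 1 / 2 - 1 / 2) * ln (real n + 1 + 1 / 2) - (real n + 1 + 1 / 2)))" for n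
    proof -
      have *: "exp (a + b - c - d) = exp a * exp b / (exp c * exp d)" for a b c d :: real
        by (simp add: exp_add exp_diff)
      show ?thesis
        unfolding q_def E_def * by (simp only: mult_ac times_divide_eq_right times_divide_eq_left)
    qed
    have lim: "(\<lambda>n. (1 - 2 * (real n + 1)) * ln 2 + ((2 * (real n + 1) - 1 / 2) * ln (2 * (real n + 1)) - 2 * (real n + 1)) -
                 ((real n + 1 - 1 / 2) * ln (real n + 1) - (real n + 1)) -
                 ((real n + 1 + 1 / 2 - 1 / 2) * ln (real n + 1 + 1 / 2) - (real n + 1 + 1 / 2)))
        \<longlonglongrightarrow> ln 2 / 2"
      by real_asymp
    have "(\<lambda>n. q n) \<longlonglongrightarrow> sqrt pi * exp (ln 2 / 2)"
      unfolding qeq by (intro tendsto_intros lim)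
    also have "sqrt pi * exp (ln 2 / 2) = sqrt (2 * pi)"
      by (simp add: real_sqrt_mult ln_sqrt[symmetric])
    finally show "q \<longlonglongrightarrow> sqrt (2 * pi)" .
  qed (real_asymp, simp)+
  then have "exp b = of_real (sqrt (2 * pi))"
    unfolding eq[symmetric] by (simp add: LIMSEQ_const_iff)
  then show ?thesis using G[OF z] by simp
qed

subsection \<open>The Borel transform of the Stirling series\<close>

text \<open>The value at \<open>0\<close> fills the removable singularity:
  \<open>\<zeta> / 2 * coth (\<zeta> / 2)\<close> begins with
  \<open>1 + \<zeta>^2 / 12\<close>.\<close>

definition stirling_borel :: "complex \<Rightarrow> complex" where
  "stirling_borel \<zeta> = (if \<zeta> = 0 then 1 / 12 else 1 / \<zeta>\<^sup>2 * (\<zeta> / 2 * coth (\<zeta> / 2) - 1))"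

lemma imaginary_cuts_eq: "imaginary_cuts = {\<zeta>. Re \<zeta> = 0 \<and> \<bar>Im \<zeta>\<bar> \<ge> 2 * pi}"
proof (intro equalityI subsetI)
  fix \<zeta> assume "\<zeta> \<in> imaginary_cuts"
  then show "\<zeta> \<in> {\<zeta>. Re \<zeta> = 0 \<and> \<bar>Im \<zeta>\<bar> \<ge> 2 * pi}"
    by (auto simp: imaginary_cuts_def abs_mult)
next
  fix \<zeta> assume *: "\<zeta> \<in> {\<zeta>. Re \<zeta> = 0 \<and> \<bar>Im \<zeta>\<bar> \<ge> 2 * pi}"
  have "\<zeta> = 2 * of_real pi * \<i> * of_real (Im \<zeta> / (2 * pi))"
       "\<zeta> = - (2 * of_real pi * \<i> * of_real (- Im \<zeta> / (2 * pi)))"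
    using * by (auto simp: complex_eq_iff)
  moreover have "Im \<zeta> / (2 * pi) \<ge> 1 \<or> - Im \<zeta> / (2 * pi) \<ge> 1"
    using * by (auto simp: field_simps abs_if split: if_splits)
  ultimately show "\<zeta> \<in> imaginary_cuts"
    unfolding imaginary_cuts_def by blast
qed

lemma zero_notin_imaginary_cuts: "0 \<notin> imaginary_cuts"
  by (simp add: imaginary_cuts_eq not_le)

lemma open_Compl_imaginary_cuts: "open (- imaginary_cuts)"
proof -
  have "closed {\<zeta>. Re \<zeta> = 0 \<and> \<bar>Im \<zeta>\<bar> \<ge> 2 * pi}"
    by (intro closed_Collect_conj closed_Collect_eq closed_Collect_le continuous_intros)
  then show ?thesis by (simp add: imaginary_cuts_eq open_Compl)
qed

text \<open>Shrinking towards the centre \<open>0\<close> cannot increase \<open>|Im x|\<close>, so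
  no segment from \<open>0\<close> runs into a cut. Starlikeness provides the primitive used to
  rotate the ray of integration.\<close>

lemma starlike_Compl_imaginary_cuts: "starlike (- imaginary_cuts)"
  unfolding starlike_def
proof (intro bexI[of _ 0] ballI subsetI)
  fix x w assume x: "x \<in> - imaginary_cuts" and "w \<in> closed_segment 0 x"
  then obtain s where s: "0 \<le> s" "s \<le> 1" "w = s *\<^sub>R x"
    by (auto simp: closed_segment_def)
  have "s * \<bar>Im x\<bar> \<le> 1 * \<bar>Im x\<bar>" using s by (intro mult_right_mono) auto
  then show "w \<in> - imaginary_cuts"
    using x s linorder_not_le[THEN iffD2, OF pi_gt_zero] by (auto simp: imaginary_cuts_eq abs_mult)
qed (simp add: zero_notin_imaginary_cuts)

text \<open>The zeros are the multiples of \<open>2 pi i\<close>; all but \<open>0\<close> lie on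
  the cuts.\<close>

lemma sinh_half_eq_0_imp:
  assumes "sinh (\<zeta> / 2) = (0::complex)"
  shows "\<zeta> = 0 \<or> \<zeta> \<in> imaginary_cuts"
proof -
  have "exp (\<zeta> / 2) ^ 2 = 1"
    using assms unfolding sinh_zero_iff by auto
  then have "exp \<zeta> = 1" by (simp add: exp_double[symmetric])
  then obtain n :: int where n: "Re \<zeta> = 0" "Im \<zeta> = of_int (2 * n) * pi"
    unfolding exp_eq_1 by auto
  show ?thesis
  proof (cases "n = 0")
    case True
    then show ?thesis using n by (simp add: complex_eq_iff)
  next
    case False
    then have "1 \<le> \<bar>n\<bar>" by simp
    then have "(1::real) \<le> \<bar>of_int n\<bar>" by linarith
    then have "2 * pi \<le> \<bar>Im \<zeta>\<bar>" by (simp add: n(2) abs_mult)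
    then show ?thesis using n(1) by (simp add: imaginary_cuts_eq)
  qed
qed

text \<open>With denominators cleared the formula also holds at \<open>0\<close>, and both sides
  make sense at \<open>2 pi i\<close> once \<open>stirling_borel\<close> is replaced by a supposed
  entire continuation.\<close>

lemma stirling_borel_eq:
  assumes "\<zeta> \<in> - imaginary_cuts"
  shows "\<zeta>\<^sup>2 * sinh (\<zeta> / 2) * stirling_borel \<zeta> = \<zeta> / 2 * cosh (\<zeta> / 2) - sinh (\<zeta> / 2)"
  using assms sinh_half_eq_0_imp[of \<zeta>]
  by (cases "\<zeta> = 0") (auto simp: stirling_borel_def coth_def field_simps)

text \<open>This is \<open>stirling_borel_eq\<close> multiplied by
  \<open>2 * exp (- (\<zeta> / 2))\<close>. Only \<open>exp (- \<zeta>)\<close> remains, which is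
  bounded for \<open>Re \<zeta> > 0\<close> and turns into a unit shift of \<open>z\<close> under
  the Laplace transform.\<close>

lemma stirling_borel_eq_exp:
  assumes "\<zeta> \<in> - imaginary_cuts"
  shows "\<zeta>\<^sup>2 * stirling_borel \<zeta> * (1 - exp (- \<zeta>)) = \<zeta> / 2 - 1 + (\<zeta> / 2 + 1) * exp (- \<zeta>)"
proof -
  have e: "exp (- \<zeta>) = exp (- (\<zeta> / 2)) * exp (- (\<zeta> / 2))" "exp (\<zeta> / 2) * exp (- (\<zeta> / 2)) = 1"
    by (simp_all add: exp_add[symmetric])
  have c: "2 * cosh (\<zeta> / 2) = exp (\<zeta> / 2) + exp (- (\<zeta> / 2))"
    and s: "2 * sinh (\<zeta> / 2) = exp (\<zeta> / 2) - exp (- (\<zeta> / 2))"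
    by (simp_all add: cosh_def sinh_def scaleR_conv_of_real)
  have "\<zeta>\<^sup>2 * stirling_borel \<zeta> * (1 - exp (- \<zeta>)) =
        2 * (\<zeta>\<^sup>2 * sinh (\<zeta> / 2) * stirling_borel \<zeta>) * exp (- (\<zeta> / 2))"
    using e s by algebra
  also have "\<dots> = \<zeta> / 2 * ((2 * cosh (\<zeta> / 2)) * exp (- (\<zeta> / 2))) - (2 * sinh (\<zeta> / 2)) * exp (- (\<zeta> / 2))"
    unfolding stirling_borel_eq[OF assms] by (simp add: algebra_simps)
  also have "\<dots> = \<zeta> / 2 * (1 + exp (- \<zeta>)) - (1 - exp (- \<zeta>))"
    unfolding c s using e by algebra
  finally show ?thesis by (simp add: algebra_simps)
qed

lemma stirling_borel_minus: "stirling_borel (- \<zeta>) = stirling_borel \<zeta>"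
  by (simp add: stirling_borel_def coth_def)

text \<open>After multiplication by \<open>sinh (\<zeta> / 2)\<close>, numerator \<open>N\<close>
  and denominator \<open>D\<close> vanish at \<open>0\<close> to order at least 3 and exactly 3, so
  the quotient is a power series. Its constant term is the ratio
  \<open>(1 / 24) / (1 / 2) = 1 / 12\<close> of the cubic coefficients.\<close>

lemma stirling_borel_has_fps_expansion: "\<exists>F. stirling_borel has_fps_expansion F"
proof -
  define N D where
    "N = fps_const (1 / 4) * fps_X * (fps_exp (1 / 2) + fps_exp (- 1 / 2)) -
         fps_const (1 / 2) * (fps_exp (1 / 2) - fps_exp (- 1 / 2 :: complex))" and
    "D = fps_X ^ 2 * (fps_const (1 / 2) * (fps_exp (1 / 2) - fps_exp (- 1 / 2 :: complex)))"
  have N: "(\<lambda>\<zeta>. 1 / 4 * \<zeta> * (exp (1 / 2 * \<zeta>) + exp (- 1 / 2 * \<zeta>)) -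
              1 / 2 * (exp (1 / 2 * \<zeta>) - exp (- 1 / 2 * \<zeta>))) has_fps_expansion N"
    unfolding N_def by (intro fps_expansion_intros)
  have D: "(\<lambda>\<zeta>. \<zeta> ^ 2 * (1 / 2 * (exp (1 / 2 * \<zeta>) - exp (- 1 / 2 * \<zeta>)))) has_fps_expansion D"
    unfolding D_def by (intro fps_expansion_intros)
  have D3: "D $ 3 = 1 / 2"
    by (simp add: D_def fps_X_power_mult_nth)
  then have D0: "D \<noteq> 0" by auto
  have sD: "subdegree D = 3"
  proof (rule subdegreeI)
    fix i :: nat assume "i < 3"
    then have "i = 0 \<or> i = 1 \<or> i = 2" by auto
    then show "D $ i = 0" by (auto simp: D_def fps_X_power_mult_nth)
  qed (simp add: D3)
  have NX: "N $ i = 1 / 4 * (if i = 0 then 0 else ((1 / 2) ^ (i - 1) + (- 1 / 2) ^ (i - 1)) / fact (i - 1)) -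
              1 / 2 * (((1 / 2) ^ i - (- 1 / 2) ^ i) / fact i)" for i
    unfolding N_def by (simp add: mult.assoc fps_X_mult_nth diff_divide_distrib add_divide_distrib)
  have N3: "N $ 3 = 1 / 24"
    by (simp add: NX fact_numeral power_numeral_reduce)
  have sN: "subdegree N \<ge> 3"
  proof (rule subdegree_geI)
    show "N \<noteq> 0" using N3 by auto
    fix i :: nat assume "i < 3"
    then have "i = 0 \<or> i = 1 \<or> i = 2" by auto
    then show "N $ i = 0" by (auto simp: NX)
  qed
  have "(\<lambda>\<zeta>. if \<zeta> = 0 then 1 / 12 else
           (1 / 4 * \<zeta> * (exp (1 / 2 * \<zeta>) + exp (- 1 / 2 * \<zeta>)) -
              1 / 2 * (exp (1 / 2 * \<zeta>) - exp (- 1 / 2 * \<zeta>))) /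
           (\<zeta> ^ 2 * (1 / 2 * (exp (1 / 2 * \<zeta>) - exp (- 1 / 2 * \<zeta>))))) has_fps_expansion N / D"
    by (intro has_fps_expansion_divide N D) (simp_all add: sN sD N3 D3 D0)
  also have "?this \<longleftrightarrow> stirling_borel has_fps_expansion N / D"
  proof (intro has_fps_expansion_cong refl)
    have "eventually (\<lambda>\<zeta>. \<zeta> \<in> - imaginary_cuts) (nhds 0)"
      using open_Compl_imaginary_cuts
      by (rule eventually_nhds_in_open) (simp add: zero_notin_imaginary_cuts)
    then show "\<forall>\<^sub>F \<zeta> in nhds 0. (if \<zeta> = 0 then 1 / 12 else
           (1 / 4 * \<zeta> * (exp (1 / 2 * \<zeta>) + exp (- 1 / 2 * \<zeta>)) -
              1 / 2 * (exp (1 / 2 * \<zeta>) - exp (- 1 / 2 * \<zeta>))) /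
           (\<zeta> ^ 2 * (1 / 2 * (exp (1 / 2 * \<zeta>) - exp (- 1 / 2 * \<zeta>))))) = stirling_borel \<zeta>"
    proof eventually_elim
      case (elim \<zeta>)
      have s: "1 / 2 * (exp (1 / 2 * \<zeta>) - exp (- 1 / 2 * \<zeta>)) = sinh (\<zeta> / 2)"
        and c: "1 / 4 * \<zeta> * (exp (1 / 2 * \<zeta>) + exp (- 1 / 2 * \<zeta>)) = \<zeta> / 2 * cosh (\<zeta> / 2)"
        by (simp_all add: cosh_def sinh_def scaleR_conv_of_real)
      show ?case unfolding s c stirling_borel_eq[OF elim, symmetric]
        using sinh_half_eq_0_imp[of \<zeta>] elim by (cases "\<zeta> = 0") (auto simp: stirling_borel_def)
    qed
  qed
  finally show ?thesis by blast
qed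

lemma holomorphic_on_sinh_cosh_half:
  "(\<lambda>\<zeta>::complex. sinh (\<zeta> / 2)) holomorphic_on A" "(\<lambda>\<zeta>::complex. cosh (\<zeta> / 2)) holomorphic_on A"
  unfolding sinh_conv_sin cosh_conv_cos by (intro holomorphic_intros; simp)+

text \<open>The quotient formula covers everything except \<open>0\<close>, and the power series
  expansion covers a neighbourhood of \<open>0\<close>; the two open sets are glued.\<close>

lemma holomorphic_on_stirling_borel: "stirling_borel holomorphic_on - imaginary_cuts"
proof -
  obtain F where "stirling_borel has_fps_expansion F"
    using stirling_borel_has_fps_expansion by blast
  then obtain s where s: "open s" "0 \<in> s" "stirling_borel holomorphic_on s"
    by (rule has_fps_expansion_imp_holomorphic)
  have op: "open (- imaginary_cuts - {0})"
    using open_Compl_imaginary_cuts by (intro open_Diff) auto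
  have "(\<lambda>\<zeta>. 1 / \<zeta>\<^sup>2 * (\<zeta> / 2 * (cosh (\<zeta> / 2) / sinh (\<zeta> / 2)) - 1)) holomorphic_on - imaginary_cuts - {0}"
    by (intro holomorphic_intros holomorphic_on_sinh_cosh_half) (use sinh_half_eq_0_imp in auto)
  then have "stirling_borel holomorphic_on - imaginary_cuts - {0}"
    by (rule holomorphic_transform) (auto simp: stirling_borel_def coth_def)
  then have "stirling_borel holomorphic_on s \<union> (- imaginary_cuts - {0})"
    using s op by (intro holomorphic_on_Un)
  then show ?thesis by (rule holomorphic_on_subset) (use s in auto)
qed

text \<open>The unit disc is handled by compactness. Outside it, with \<open>r = |\<zeta>|\<close>,
  the right side of \<open>stirling_borel_eq_exp\<close> is at most
  \<open>r + 2 \<le> 3 r^2\<close>, while \<open>Re \<zeta> \<ge> c\<close> gives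
  \<open>|1 - exp (- \<zeta>)| \<ge> 1 - exp (- c)\<close>. The bound depends on the opening of the
  cone only through \<open>c\<close>.\<close>

lemma stirling_borel_bound:
  obtains C where "C > 0"
    "\<And>c \<zeta>. c > 0 \<Longrightarrow> Re \<zeta> \<ge> c * norm \<zeta> \<Longrightarrow> norm (stirling_borel \<zeta>) \<le> C + 3 / (1 - exp (- c))"
proof -
  have "cball 0 1 \<subseteq> - imaginary_cuts"
  proof
    fix w :: complex assume "w \<in> cball 0 1"
    then have "\<bar>Im w\<bar> \<le> 1" using abs_Im_le_cmod[of w] by simp
    then show "w \<in> - imaginary_cuts" using pi_gt3 by (auto simp: imaginary_cuts_eq)
  qed
  then have "compact (stirling_borel ` cball 0 1)"
    using holomorphic_on_imp_continuous_on[OF holomorphic_on_stirling_borel]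
    by (intro compact_continuous_image) (auto intro: continuous_on_subset)
  then have "bounded (stirling_borel ` cball 0 1)" by (rule compact_imp_bounded)
  then obtain C where C: "C > 0" "\<And>\<zeta>. norm \<zeta> \<le> 1 \<Longrightarrow> norm (stirling_borel \<zeta>) \<le> C"
    unfolding bounded_pos by auto
  show ?thesis
  proof (rule that[OF C(1)])
    fix c \<zeta> assume c: "c > 0" and \<zeta>: "Re \<zeta> \<ge> c * norm \<zeta>"
    have ec: "1 - exp (- c) > 0" using c by simp
    show "norm (stirling_borel \<zeta>) \<le> C + 3 / (1 - exp (- c))"
    proof (cases "norm \<zeta> \<le> 1")
      case True
      have "3 / (1 - exp (- c)) \<ge> 0" using ec by simp
      with C(2)[OF True] show ?thesis by linarith
    next
      case False
      define r where "r = norm \<zeta>"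
      have r: "r > 1" using False by (simp add: r_def)
      have "c * 1 \<le> c * norm \<zeta>" using False c by (intro mult_left_mono) auto
      then have Re: "Re \<zeta> \<ge> c" using \<zeta> by linarith
      have cut: "\<zeta> \<in> - imaginary_cuts" using Re c by (auto simp: imaginary_cuts_eq)
      have e: "norm (exp (- \<zeta>)) \<le> exp (- c)" using Re by simp
      have e1: "norm (exp (- \<zeta>)) \<le> 1" using Re c by simp
      have n1: "1 - exp (- c) \<le> norm (1 - exp (- \<zeta>))"
        using norm_triangle_ineq2[of 1 "exp (- \<zeta>)"] e unfolding norm_one by linarith
      have "r\<^sup>2 * norm (stirling_borel \<zeta>) * (1 - exp (- c)) \<le>
            r\<^sup>2 * norm (stirling_borel \<zeta>) * norm (1 - exp (- \<zeta>))"
        by (intro mult_left_mono n1) auto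
      also have "\<dots> = norm (\<zeta> / 2 - 1 + (\<zeta> / 2 + 1) * exp (- \<zeta>))"
        unfolding stirling_borel_eq_exp[OF cut, symmetric] r_def by (simp add: norm_mult norm_power)
      also have "\<dots> \<le> norm (\<zeta> / 2 - 1) + norm ((\<zeta> / 2 + 1) * exp (- \<zeta>))"
        by (rule norm_triangle_ineq)
      also have "\<dots> \<le> (r / 2 + 1) + (r / 2 + 1) * 1"
        unfolding norm_mult r_def
        using norm_triangle_ineq4[of "\<zeta> / 2" 1] norm_triangle_ineq[of "\<zeta> / 2" 1] e1
        by (intro add_mono mult_mono) (auto simp: norm_divide)
      also have "\<dots> \<le> 3 * r\<^sup>2"
      proof -
        have "r \<le> r\<^sup>2" using r power_increasing[of 1 2 r] by simp
        moreover have "(r / 2 + 1) + (r / 2 + 1) * 1 = r + 2" by simp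
        ultimately show ?thesis using r by linarith
      qed
      finally have "r\<^sup>2 * (norm (stirling_borel \<zeta>) * (1 - exp (- c))) \<le> r\<^sup>2 * 3"
        by (simp add: mult_ac)
      then have "norm (stirling_borel \<zeta>) * (1 - exp (- c)) \<le> 3"
        using r by (subst (asm) mult_le_cancel_left_pos) auto
      then have "norm (stirling_borel \<zeta>) \<le> 3 / (1 - exp (- c))"
        using ec by (simp add: field_simps)
      then show ?thesis using C(1) by simp
    qed
  qed
qed

text \<open>If the series were entire, the identity theorem would extend
  \<open>stirling_borel_eq\<close> to \<open>2 pi i\<close>. There \<open>sinh\<close> vanishes and
  kills the left side, whereas \<open>cosh (pi i) = -1\<close> makes the right side nonzero.\<close>

lemma stirling_borel_not_entire:
  assumes "stirling_borel has_fps_expansion F"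
  shows "fps_conv_radius F \<noteq> \<infinity>"
proof
  assume inf: "fps_conv_radius F = \<infinity>"
  define h where "h = (\<lambda>\<zeta>. \<zeta>\<^sup>2 * sinh (\<zeta> / 2) * eval_fps F \<zeta> - (\<zeta> / 2 * cosh (\<zeta> / 2) - sinh (\<zeta> / 2)))"
  have h: "h holomorphic_on UNIV"
    unfolding h_def by (intro holomorphic_intros holomorphic_on_sinh_cosh_half) (auto simp: inf)
  have "eventually (\<lambda>\<zeta>. eval_fps F \<zeta> = stirling_borel \<zeta>) (nhds 0)"
    using assms by (simp add: has_fps_expansion_def)
  moreover have "eventually (\<lambda>\<zeta>. \<zeta> \<in> - imaginary_cuts) (nhds 0)"
    using open_Compl_imaginary_cuts
    by (rule eventually_nhds_in_open) (simp add: zero_notin_imaginary_cuts)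
  ultimately have "eventually (\<lambda>\<zeta>. h \<zeta> = 0) (nhds 0)"
    by eventually_elim (simp add: h_def stirling_borel_eq)
  then obtain s where s: "open s" "0 \<in> s" "\<And>\<zeta>. \<zeta> \<in> s \<Longrightarrow> h \<zeta> = 0"
    unfolding eventually_nhds by blast
  have "h (2 * of_real pi * \<i>) = 0"
    by (rule analytic_continuation_open[of s UNIV h "\<lambda>_. 0"]) (use s h in auto)
  moreover have "\<i> * (of_real pi * \<i>) = - of_real pi"
    by (simp add: complex_eq_iff)
  ultimately show False
    by (simp add: h_def sinh_conv_sin cosh_conv_cos)
qed

text \<open>A positive radius of convergence bounds the coefficients geometrically by
  \<open>K / s^n\<close>. Division by \<open>fact n\<close> then yields a series dominated by an
  exponential series for every \<open>r\<close>, so the Borel transform would be entire.\<close>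

lemma fps_divergent_of_formal_borel:
  assumes "fps_conv_radius (formal_borel \<phi>) \<noteq> \<infinity>"
  shows "fps_divergent \<phi>"
proof (rule ccontr)
  assume "\<not> fps_divergent \<phi>"
  moreover have "fps_conv_radius \<phi> \<ge> 0"
    by (simp add: fps_conv_radius_def conv_radius_nonneg)
  ultimately have "fps_conv_radius \<phi> > 0"
    unfolding fps_divergent_def by simp
  then obtain s where s: "0 < ereal s" "ereal s < fps_conv_radius \<phi>"
    using ereal_dense2 by blast
  then have s0: "s > 0" by simp
  have "summable (\<lambda>n. fps_nth \<phi> n * of_real s ^ n)"
    using s by (intro summable_fps) auto
  then have "Bseq (\<lambda>n. fps_nth \<phi> n * of_real s ^ n)"
    by (intro convergent_imp_Bseq convergentI[OF summable_LIMSEQ_zero])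
  then obtain K where K: "K > 0" "\<And>n. norm (fps_nth \<phi> n * of_real s ^ n) \<le> K"
    unfolding Bseq_def by auto
  have "conv_radius (fps_nth (formal_borel \<phi>)) \<ge> \<infinity>"
  proof (rule conv_radius_geI_ex')
    fix r :: real assume r: "r > 0"
    show "summable (\<lambda>n. fps_nth (formal_borel \<phi>) n * of_real r ^ n)"
    proof (rule summable_comparison_test')
      show "summable (\<lambda>n. K / s * (inverse (fact n) * (r / s) ^ n))"
        by (intro summable_mult summable_exp)
      fix n :: nat
      have "norm (fps_nth \<phi> (Suc n)) \<le> K / s ^ Suc n"
        using K(2)[of "Suc n"] s0 by (simp add: norm_mult norm_power field_simps)
      then have "norm (fps_nth \<phi> (Suc n)) * (r ^ n / fact n) \<le> K / s ^ Suc n * (r ^ n / fact n)"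
        using r by (intro mult_right_mono) auto
      then show "norm (fps_nth (formal_borel \<phi>) n * of_real r ^ n) \<le> K / s * (inverse (fact n) * (r / s) ^ n)"
        using r s0 by (simp add: formal_borel_def norm_mult norm_divide norm_power field_simps)
    qed
  qed
  then show False using assms by (simp add: fps_conv_radius_def)
qed

subsection \<open>Rotation of the ray of integration\<close>

text \<open>The factor \<open>cis \<theta>\<close> comes from parametrising the ray. With it, the
  transform evaluated at \<open>z * cis \<theta>\<close> is the Laplace integral of
  \<open>stirling_borel\<close> at \<open>z\<close> in direction \<open>\<theta>\<close>.\<close>

definition stirling_borel_ray :: "real \<Rightarrow> real \<Rightarrow> complex" where
  "stirling_borel_ray \<theta> \<xi> = stirling_borel (of_real \<xi> * cis \<theta>) * cis \<theta>"

lemma ray_in_Compl_imaginary_cuts: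
  assumes "\<theta> \<in> {- (pi / 2)<..<pi / 2}" "\<xi> \<ge> 0"
  shows "of_real \<xi> * cis \<theta> \<in> - imaginary_cuts"
proof (cases "\<xi> = 0")
  case False
  then have "Re (of_real \<xi> * cis \<theta>) \<noteq> 0"
    using assms cos_gt_zero_pi[of \<theta>] by auto
  then show ?thesis by (auto simp: imaginary_cuts_eq)
qed (simp add: zero_notin_imaginary_cuts)

lemma laplace_integrable_stirling_borel_ray:
  assumes "\<theta> \<in> {- (pi / 2)<..<pi / 2}"
  shows "laplace_integrable (stirling_borel_ray \<theta>)"
proof -
  obtain C where C: "\<And>c \<zeta>. c > 0 \<Longrightarrow> Re \<zeta> \<ge> c * norm \<zeta> \<Longrightarrow> norm (stirling_borel \<zeta>) \<le> C + 3 / (1 - exp (- c))"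
    using stirling_borel_bound by metis
  show ?thesis
  proof (rule laplace_integrable_bounded)
    show "continuous_on {0<..} (stirling_borel_ray \<theta>)"
      unfolding stirling_borel_ray_def
      by (intro continuous_intros
            continuous_on_compose2[OF holomorphic_on_imp_continuous_on[OF holomorphic_on_stirling_borel]])
         (use assms ray_in_Compl_imaginary_cuts in auto)
    show "norm (stirling_borel_ray \<theta> t) \<le> C + 3 / (1 - exp (- cos \<theta>))" if "t > 0" for t
      using C[of "cos \<theta>" "of_real t * cis \<theta>"] assms cos_gt_zero_pi[of \<theta>] that
      by (simp add: stirling_borel_ray_def norm_mult)
  qed
qed

text \<open>The integrand has a primitive \<open>H\<close> on the cut plane, and the
  values of \<open>H\<close> at \<open>n e\<^sup>i\<^sup>\<alpha>\<close> and \<open>n e\<^sup>i\<^sup>\<beta>\<close> differ by an exponentially small quantity.\<close>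

lemma laplace_stirling_borel_ray_cong:
  assumes \<alpha>: "\<alpha> \<in> {- (pi / 2)<..<pi / 2}" "Re (z * cis \<alpha>) > 0"
    and \<beta>: "\<beta> \<in> {- (pi / 2)<..<pi / 2}" "Re (z * cis \<beta>) > 0"
  shows "laplace (stirling_borel_ray \<alpha>) (z * cis \<alpha>) = laplace (stirling_borel_ray \<beta>) (z * cis \<beta>)"
proof -
  define h where "h = (\<lambda>\<zeta>. exp (- z * \<zeta>) * stirling_borel \<zeta>)"
  have h: "h holomorphic_on - imaginary_cuts"
    unfolding h_def by (intro holomorphic_intros holomorphic_on_stirling_borel)
  have "\<exists>H. \<forall>\<zeta>\<in>- imaginary_cuts. (H has_field_derivative h \<zeta>) (at \<zeta>)"
    using holomorphic_on_imp_continuous_on[OF h] starlike_Compl_imaginary_cuts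
      open_Compl_imaginary_cuts finite.emptyI
    by (rule holomorphic_starlike_primitive)
       (use h open_Compl_imaginary_cuts in \<open>auto intro: holomorphic_on_imp_differentiable_at\<close>)
  then obtain H where H: "\<And>\<zeta>. \<zeta> \<in> - imaginary_cuts \<Longrightarrow> (H has_field_derivative h \<zeta>) (at \<zeta>)"
    by blast
  have lim: "(\<lambda>n. H (of_real (real n) * cis \<theta>) - H 0) \<longlonglongrightarrow> laplace (stirling_borel_ray \<theta>) (z * cis \<theta>)"
    if \<theta>: "\<theta> \<in> {- (pi / 2)<..<pi / 2}" "Re (z * cis \<theta>) > 0" for \<theta>
  proof -
    have "integral {0..real n} (\<lambda>t. exp (- (z * cis \<theta>) * of_real t) * stirling_borel_ray \<theta> t) =
          H (of_real (real n) * cis \<theta>) - H 0" for n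
    proof -
      have "((\<lambda>t. exp (- (z * cis \<theta>) * of_real t) * stirling_borel_ray \<theta> t) has_integral
              H (of_real (real n) * cis \<theta>) - H (of_real 0 * cis \<theta>)) {0..real n}"
      proof (rule fundamental_theorem_of_calculus)
        fix t assume "t \<in> {0..real n}"
        then have t: "of_real t * cis \<theta> \<in> - imaginary_cuts"
          using \<theta>(1) by (intro ray_in_Compl_imaginary_cuts) auto
        have "((\<lambda>w. H (w * cis \<theta>)) has_field_derivative h (of_real t * cis \<theta>) * cis \<theta>) (at (of_real t))"
          by (rule DERIV_chain2[where f = H and g = "\<lambda>w. w * cis \<theta>", OF H[OF t]])
             (auto intro!: derivative_eq_intros)
        then have "((\<lambda>s. H (of_real s * cis \<theta>)) has_vector_derivative h (of_real t * cis \<theta>) * cis \<theta>)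
                    (at t within {0..real n})"
          by (rule has_vector_derivative_real_field)
        also have "h (of_real t * cis \<theta>) * cis \<theta> = exp (- (z * cis \<theta>) * of_real t) * stirling_borel_ray \<theta> t"
          by (simp add: h_def stirling_borel_ray_def mult_ac)
        finally show "((\<lambda>s. H (of_real s * cis \<theta>)) has_vector_derivative
            exp (- (z * cis \<theta>) * of_real t) * stirling_borel_ray \<theta> t) (at t within {0..real n})" .
      qed auto
      then show ?thesis by (simp add: integral_unique)
    qed
    then show ?thesis
      using tendsto_integral_Ioi[OF laplace_integrand_integrable[OF
            laplace_integrable_stirling_borel_ray[OF \<theta>(1)] \<theta>(2)]]
      by (simp add: laplace_def)
  qed
  obtain C where C: "C > 0"
    "\<And>c \<zeta>. c > 0 \<Longrightarrow> Re \<zeta> \<ge> c * norm \<zeta> \<Longrightarrow> norm (stirling_borel \<zeta>) \<le> C + 3 / (1 - exp (- c))"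
    by (rule stirling_borel_bound) (rule that)
  \<comment> \<open>\<open>c\<close> is a cone constant and \<open>d\<close> a decay rate valid on
    both rays. The inequalities \<open>Re \<zeta> \<ge> n * c\<close> and
    \<open>Re (z * \<zeta>) \<ge> n * d\<close> are linear in \<open>\<zeta>\<close>, so they pass
    from the endpoints to the chord between them.\<close>
  define c where "c = min (cos \<alpha>) (cos \<beta>)"
  define d where "d = min (Re (z * cis \<alpha>)) (Re (z * cis \<beta>))"
  define B where "B = C + 3 / (1 - exp (- c))"
  have c: "c > 0" using \<alpha> \<beta> cos_gt_zero_pi by (auto simp: c_def)
  have d: "d > 0" using \<alpha> \<beta> by (auto simp: d_def)
  \<comment> \<open>The rays are joined by a chord instead of an arc. Its length is at most
    \<open>2 n\<close>, and the derivative \<open>h\<close> of \<open>H\<close> is exponentially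
    small on it.\<close>
  have est: "norm (H (of_real (real n) * cis \<alpha>) - H (of_real (real n) * cis \<beta>)) \<le>
              exp (- d * real n) * B * (2 * real n)" if n: "n > 0" for n
  proof -
    let ?a = "of_real (real n) * cis \<alpha>" and ?b = "of_real (real n) * cis \<beta>"
    have seg: "\<zeta> \<in> - imaginary_cuts \<and> norm (h \<zeta>) \<le> exp (- d * real n) * B"
      if \<zeta>: "\<zeta> \<in> closed_segment ?a ?b" for \<zeta>
    proof -
      obtain s where s: "0 \<le> s" "s \<le> 1" "\<zeta> = (1 - s) *\<^sub>R ?a + s *\<^sub>R ?b"
        using \<zeta> unfolding in_segment by blast
      have conv: "m \<le> (1 - s) * x + s * y" if "m \<le> x" "m \<le> y" for m x y :: real
      proof -
        have "(1 - s) * m + s * m \<le> (1 - s) * x + s * y"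
          using that s by (intro add_mono mult_left_mono) auto
        then show ?thesis by (simp add: algebra_simps)
      qed
      have Re\<zeta>: "real n * c \<le> Re \<zeta>"
        unfolding s(3) using conv[of "real n * c" "real n * cos \<alpha>" "real n * cos \<beta>"]
        by (simp add: c_def mult_left_mono)
      have "real n * d \<le> (1 - s) * (real n * Re (z * cis \<alpha>)) + s * (real n * Re (z * cis \<beta>))"
        by (intro conv mult_left_mono) (auto simp: d_def)
      also have "\<dots> = Re (z * \<zeta>)"
        unfolding s(3) by (simp add: algebra_simps)
      finally have Rez\<zeta>: "real n * d \<le> Re (z * \<zeta>)" .
      have "norm \<zeta> \<le> norm ((1 - s) *\<^sub>R ?a) + norm (s *\<^sub>R ?b)"
        unfolding s(3) by (rule norm_triangle_ineq)
      also have "\<dots> = (1 - s) * real n + s * real n"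
        using s(1,2) by (simp add: norm_mult)
      also have "\<dots> = real n" by (simp add: algebra_simps)
      finally have "c * norm \<zeta> \<le> c * real n" using c by (intro mult_left_mono) auto
      with Re\<zeta> have "c * norm \<zeta> \<le> Re \<zeta>" by (simp add: mult.commute)
      then have M: "norm (stirling_borel \<zeta>) \<le> B" unfolding B_def using c by (intro C(2))
      have "norm (h \<zeta>) = exp (- Re (z * \<zeta>)) * norm (stirling_borel \<zeta>)"
        by (simp add: h_def norm_mult)
      also have "\<dots> \<le> exp (- d * real n) * B"
        using M Rez\<zeta> by (intro mult_mono) (auto simp: mult.commute)
      finally have "norm (h \<zeta>) \<le> exp (- d * real n) * B" .
      moreover have "Re \<zeta> > 0" using Re\<zeta> c n by (smt (verit) mult_pos_pos of_nat_0_less_iff)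
      then have "\<zeta> \<in> - imaginary_cuts" by (auto simp: imaginary_cuts_eq)
      ultimately show ?thesis by blast
    qed
    have "norm (H ?a - H ?b) \<le> exp (- d * real n) * B * norm (?a - ?b)"
      by (rule field_differentiable_bound[OF convex_closed_segment[of ?a ?b], of H h])
         (use seg H in \<open>auto intro: has_field_derivative_at_within\<close>)
    also have "\<dots> \<le> exp (- d * real n) * B * (2 * real n)"
    proof (rule mult_left_mono)
      show "norm (?a - ?b) \<le> 2 * real n"
        using norm_triangle_ineq4[of ?a ?b] by (simp add: norm_mult)
      \<comment> \<open>The bound is nonnegative because it dominates a norm at an endpoint of the
        chord.\<close>
      show "0 \<le> exp (- d * real n) * B"
        using norm_ge_zero[of "h ?a"] seg[OF ends_in_segment(1)] by linarith
    qed
    finally show ?thesis .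
  qed
  have "(\<lambda>n. H (of_real (real n) * cis \<alpha>) - H (of_real (real n) * cis \<beta>)) \<longlonglongrightarrow> 0"
  proof (rule Lim_null_comparison)
    show "\<forall>\<^sub>F n in sequentially. norm (H (of_real (real n) * cis \<alpha>) - H (of_real (real n) * cis \<beta>)) \<le>
              exp (- d * real n) * B * (2 * real n)"
      using eventually_gt_at_top[of 0] by eventually_elim (rule est)
    show "(\<lambda>n. exp (- d * real n) * B * (2 * real n)) \<longlonglongrightarrow> 0"
      using d by real_asymp
  qed
  moreover have "(\<lambda>n. (H (of_real (real n) * cis \<alpha>) - H 0) - (H (of_real (real n) * cis \<beta>) - H 0)) \<longlonglongrightarrow>
      laplace (stirling_borel_ray \<alpha>) (z * cis \<alpha>) - laplace (stirling_borel_ray \<beta>) (z * cis \<beta>)"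
    by (intro tendsto_diff lim \<alpha> \<beta>)
  ultimately show ?thesis
    using LIMSEQ_unique by fastforce
qed

section \<open>The sector, the Borel domain and uniqueness of the continuation\<close>

lemma open_sector_right: "open_sector {- (pi / 2)<..<pi / 2} = {\<zeta>. Re \<zeta> > 0}"
proof (intro equalityI subsetI)
  fix \<zeta> assume "\<zeta> \<in> {\<zeta>. Re \<zeta> > 0}"
  then have *: "Re \<zeta> > 0" by simp
  then have "\<zeta> \<noteq> 0" by auto
  then have "\<zeta> = of_real (norm \<zeta>) * cis (Arg \<zeta>)" "norm \<zeta> > 0" "Arg \<zeta> \<in> {- (pi / 2)<..<pi / 2}"
    using * Arg_eq[of \<zeta>] Arg_Re_pos[of \<zeta>] by (auto simp: cis_conv_exp mult_ac)
  then show "\<zeta> \<in> open_sector {- (pi / 2)<..<pi / 2}"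
    unfolding open_sector_def by blast
qed (use cos_gt_zero_pi in \<open>auto simp: open_sector_def\<close>)

lemma borel_domain_right: "borel_domain {- (pi / 2)<..<pi / 2} (\<lambda>_. 0) = - \<real>\<^sub>\<le>\<^sub>0"
proof (intro equalityI subsetI)
  fix z assume "z \<in> borel_domain {- (pi / 2)<..<pi / 2} (\<lambda>_. 0)"
  then obtain \<theta> where \<theta>: "\<theta> \<in> {- (pi / 2)<..<pi / 2}" "Re (z * cis \<theta>) > 0"
    by (auto simp: borel_domain_def half_plane_def)
  show "z \<in> - \<real>\<^sub>\<le>\<^sub>0"
  proof
    assume "z \<in> \<real>\<^sub>\<le>\<^sub>0"
    then have "Re z \<le> 0" "Im z = 0" by (auto simp: complex_nonpos_Reals_iff)
    moreover have "cos \<theta> > 0" using \<theta>(1) cos_gt_zero_pi by auto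
    ultimately show False using \<theta>(2) by (auto simp: zero_less_mult_iff)
  qed
next
  fix z :: complex assume z: "z \<in> - \<real>\<^sub>\<le>\<^sub>0"
  then have z0: "z \<noteq> 0" by auto
  \<comment> \<open>Rotating by minus half the argument leaves \<open>z * cis \<theta>\<close> with
    argument \<open>Arg z / 2\<close>, of modulus below \<open>pi / 2\<close> off the cut.\<close>
  define \<theta> where "\<theta> = - Arg z / 2"
  have "Arg z \<noteq> pi" using z by (auto simp: Arg_eq_pi complex_nonpos_Reals_iff)
  then have Arg: "- pi < Arg z" "Arg z < pi" using Arg_bounded[of z] by auto
  then have \<theta>: "\<theta> \<in> {- (pi / 2)<..<pi / 2}" by (auto simp: \<theta>_def)
  have "z = of_real (norm z) * cis (Arg z)"
    using Arg_eq[OF z0] by (simp add: cis_conv_exp mult_ac)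
  then have "z * cis \<theta> = (of_real (norm z) * cis (Arg z)) * cis \<theta>" by simp
  also have "\<dots> = of_real (norm z) * cis (Arg z / 2)"
    by (simp add: mult.assoc cis_mult \<theta>_def)
  finally have "Re (z * cis \<theta>) = norm z * cos (Arg z / 2)" by simp
  also have "\<dots> > 0" using z0 Arg by (intro mult_pos_pos cos_gt_zero_pi) auto
  finally show "z \<in> borel_domain {- (pi / 2)<..<pi / 2} (\<lambda>_. 0)"
    using \<theta> by (auto simp: borel_domain_def half_plane_def)
qed

text \<open>Both functions equal the sum of \<open>F\<close> near \<open>0\<close>, and
  \<open>U\<close> meets every neighbourhood of \<open>0\<close>; the identity theorem does the
  rest. This pins down the values of \<open>sector_continuation\<close>, which is only a
  choice.\<close>

lemma continues_germ_to_unique: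
  assumes f: "continues_germ_to f F U" and g: "continues_germ_to g F U"
    and U: "open U" "connected U" "0 \<in> closure U" and z: "z \<in> U"
  shows "f z = g z"
proof -
  have "eventually (\<lambda>\<zeta>. eval_fps F \<zeta> = f \<zeta>) (nhds 0)" "eventually (\<lambda>\<zeta>. eval_fps F \<zeta> = g \<zeta>) (nhds 0)"
    using f g by (auto simp: continues_germ_to_def has_fps_expansion_def)
  then have "eventually (\<lambda>\<zeta>. f \<zeta> = g \<zeta>) (nhds 0)" by eventually_elim simp
  then obtain s where s: "open s" "0 \<in> s" "\<And>\<zeta>. \<zeta> \<in> s \<Longrightarrow> f \<zeta> = g \<zeta>"
    unfolding eventually_nhds by blast
  have "s \<inter> U \<noteq> {}"
    using s(2) U(3) open_Int_closure_eq_empty[OF s(1), of U] by blast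
  moreover have "f holomorphic_on U" "g holomorphic_on U"
    using f g by (simp_all add: continues_germ_to_def)
  ultimately show ?thesis
    using analytic_continuation_open[OF open_Int[OF s(1) U(1)] U(1) _ U(2) Int_lower2 _ _ _ z] s(3)
    by blast
qed

subsection \<open>The Borel sum\<close>

text \<open>The description is unique because \<open>z\<close> lies in the half-plane of at least
  one direction, where the integral has only one value.\<close>

lemma borel_sum_eqI:
  assumes "\<And>\<theta>. \<theta> \<in> I \<Longrightarrow> z \<in> half_plane \<theta> (\<gamma> \<theta>) \<Longrightarrow>
     ((\<lambda>\<xi>. exp (- z * of_real \<xi> * cis \<theta>) *
            sector_continuation I (formal_borel \<phi>) (of_real \<xi> * cis \<theta>) * cis \<theta>)
        has_integral w) {0<..}"
    and "z \<in> borel_domain I \<gamma>"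
  shows "borel_sum I \<gamma> \<phi> z = w"
  unfolding borel_sum_def
proof (rule the_equality)
  show "\<forall>\<theta>\<in>I. z \<in> half_plane \<theta> (\<gamma> \<theta>) \<longrightarrow>
     ((\<lambda>\<xi>. exp (- z * of_real \<xi> * cis \<theta>) *
            sector_continuation I (formal_borel \<phi>) (of_real \<xi> * cis \<theta>) * cis \<theta>)
        has_integral w) {0<..}"
    using assms(1) by blast
next
  fix v assume v: "\<forall>\<theta>\<in>I. z \<in> half_plane \<theta> (\<gamma> \<theta>) \<longrightarrow>
     ((\<lambda>\<xi>. exp (- z * of_real \<xi> * cis \<theta>) *
            sector_continuation I (formal_borel \<phi>) (of_real \<xi> * cis \<theta>) * cis \<theta>)
        has_integral v) {0<..}"
  obtain \<theta> where "\<theta> \<in> I" "z \<in> half_plane \<theta> (\<gamma> \<theta>)"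
    using assms(2) by (auto simp: borel_domain_def)
  with v assms(1) show "v = w"
    by (blast intro: has_integral_unique)
qed

lemma stirling_borel_continues_germ_to_sector:
  assumes "stirling_borel has_fps_expansion F"
  shows "continues_germ_to stirling_borel F (open_sector {- (pi / 2)<..<pi / 2})"
proof -
  have "open_sector {- (pi / 2)<..<pi / 2} \<subseteq> - imaginary_cuts"
    by (auto simp: open_sector_right imaginary_cuts_eq)
  then show ?thesis
    using assms holomorphic_on_subset[OF holomorphic_on_stirling_borel]
    by (simp add: continues_germ_to_def)
qed

text \<open>On the sector the chosen continuation is \<open>stirling_borel\<close>, and
  \<open>laplace_stirling_borel_ray_cong\<close> makes the integrals in all admissible directions
  equal.\<close>

lemma borel_sum_eq_laplace:
  assumes F: "stirling_borel has_fps_expansion formal_borel \<phi>"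
    and \<theta>: "\<theta> \<in> {- (pi / 2)<..<pi / 2}" "Re (z * cis \<theta>) > 0"
  shows "borel_sum {- (pi / 2)<..<pi / 2} (\<lambda>_. 0) \<phi> z = laplace (stirling_borel_ray \<theta>) (z * cis \<theta>)"
proof (rule borel_sum_eqI)
  let ?I = "{- (pi / 2)<..<pi / 2}"
  show "z \<in> borel_domain ?I (\<lambda>_. 0)"
    using \<theta> by (auto simp: borel_domain_def half_plane_def)
  have germ: "continues_germ_to stirling_borel (formal_borel \<phi>) (open_sector ?I)"
    by (rule stirling_borel_continues_germ_to_sector[OF F])
  then have "continues_germ_to (sector_continuation ?I (formal_borel \<phi>)) (formal_borel \<phi>) (open_sector ?I)"
    unfolding sector_continuation_def
    by (rule someI[of "\<lambda>f. continues_germ_to f (formal_borel \<phi>) (open_sector ?I)"])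
  moreover have "open (open_sector ?I)" "connected (open_sector ?I)"
    unfolding open_sector_right
    by (auto simp: open_halfspace_Re_gt convex_halfspace_Re_gt convex_connected)
  moreover have "0 \<in> closure (open_sector ?I)"
    unfolding open_sector_right closure_approachable
  proof (intro allI impI)
    fix e :: real assume "e > 0"
    then show "\<exists>y\<in>{\<zeta>. Re \<zeta> > 0}. dist y 0 < e"
      by (intro bexI[of _ "of_real (e / 2)"]) auto
  qed
  ultimately have sc: "sector_continuation ?I (formal_borel \<phi>) \<zeta> = stirling_borel \<zeta>"
    if "\<zeta> \<in> open_sector ?I" for \<zeta>
    using germ that by (blast intro: continues_germ_to_unique)
  fix \<beta> assume \<beta>: "\<beta> \<in> ?I" "z \<in> half_plane \<beta> 0"
  then have Re: "Re (z * cis \<beta>) > 0" by (simp add: half_plane_def)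
  have "((\<lambda>\<xi>. exp (- (z * cis \<beta>) * of_real \<xi>) * stirling_borel_ray \<beta> \<xi>) has_integral
          laplace (stirling_borel_ray \<beta>) (z * cis \<beta>)) {0<..}"
    by (intro laplace_has_integral laplace_integrable_stirling_borel_ray \<beta> Re)
  also have "laplace (stirling_borel_ray \<beta>) (z * cis \<beta>) = laplace (stirling_borel_ray \<theta>) (z * cis \<theta>)"
    by (intro laplace_stirling_borel_ray_cong \<beta> Re \<theta>)
  finally show "((\<lambda>\<xi>. exp (- z * of_real \<xi> * cis \<beta>) *
            sector_continuation ?I (formal_borel \<phi>) (of_real \<xi> * cis \<beta>) * cis \<beta>)
        has_integral laplace (stirling_borel_ray \<theta>) (z * cis \<theta>)) {0<..}"
  proof (rule has_integral_eq[rotated])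
    fix \<xi> :: real assume "\<xi> \<in> {0<..}"
    then have "of_real \<xi> * cis \<beta> \<in> open_sector ?I"
      using \<beta>(1) by (auto simp: open_sector_def)
    then show "exp (- (z * cis \<beta>) * of_real \<xi>) * stirling_borel_ray \<beta> \<xi> =
       exp (- z * of_real \<xi> * cis \<beta>) *
            sector_continuation ?I (formal_borel \<phi>) (of_real \<xi> * cis \<beta>) * cis \<beta>"
      by (simp add: sc stirling_borel_ray_def mult_ac)
  qed
qed

text \<open>On each half-plane of the union the Borel sum is the transform along one fixed ray,
  composed with a rotation.\<close>

lemma holomorphic_on_borel_sum:
  assumes F: "stirling_borel has_fps_expansion formal_borel \<phi>"
  shows "borel_sum {- (pi / 2)<..<pi / 2} (\<lambda>_. 0) \<phi> holomorphic_on
         borel_domain {- (pi / 2)<..<pi / 2} (\<lambda>_. 0)"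
  unfolding borel_domain_def
proof (rule holomorphic_on_UN_open)
  fix \<theta> :: real assume \<theta>: "\<theta> \<in> {- (pi / 2)<..<pi / 2}"
  show op: "open (half_plane \<theta> 0)"
    unfolding half_plane_def by (intro open_Collect_less continuous_intros)
  have "(laplace (stirling_borel_ray \<theta>) \<circ> (\<lambda>z. z * cis \<theta>)) holomorphic_on half_plane \<theta> 0"
    by (rule holomorphic_on_compose_gen[OF _
          holomorphic_on_laplace[OF laplace_integrable_stirling_borel_ray[OF \<theta>]]])
       (auto simp: half_plane_def intro!: holomorphic_intros)
  then show "borel_sum {- (pi / 2)<..<pi / 2} (\<lambda>_. 0) \<phi> holomorphic_on half_plane \<theta> 0"
    by (rule holomorphic_transform)
       (use borel_sum_eq_laplace[OF F \<theta>] in \<open>auto simp: half_plane_def\<close>)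
qed

lemma stirling_factor_eq_exp_laplace:
  assumes z: "Re z > 0"
  shows "stirling_factor z = exp (laplace (stirling_borel_ray 0) z)"
proof -
  have z0: "z \<noteq> 0" using z by auto
  have "Gamma z = of_real (sqrt (2 * pi)) * exp ((z - 1 / 2) * Ln z - z + laplace (stirling_borel_ray 0) z)"
  proof (rule Gamma_eq_exp_laplace[OF _ _ z])
    show "laplace_integrable (stirling_borel_ray 0)"
      by (rule laplace_integrable_stirling_borel_ray) auto
    fix t :: real assume "t > 0"
    then have "of_real t \<in> - imaginary_cuts" by (auto simp: imaginary_cuts_eq)
    from stirling_borel_eq_exp[OF this]
    show "of_real t * (of_real t * stirling_borel_ray 0 t) * (1 - exp (- of_real t)) =
          of_real t / 2 - 1 + (of_real t / 2 + 1) * exp (- of_real t)"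
      by (simp add: stirling_borel_ray_def power2_eq_square mult_ac)
  qed
  moreover have "z powr (1 / 2 - z) * exp z * exp ((z - 1 / 2) * Ln z - z + laplace (stirling_borel_ray 0) z) =
                 exp (laplace (stirling_borel_ray 0) z)"
    using z0 by (simp add: powr_def exp_add[symmetric] algebra_simps)
  moreover have "of_real (sqrt (2 * pi)) \<noteq> (0 :: complex)" by simp
  ultimately show ?thesis
    unfolding stirling_factor_def by (simp add: field_simps)
qed

lemma holomorphic_on_stirling_factor: "stirling_factor holomorphic_on - \<real>\<^sub>\<le>\<^sub>0"
proof -
  have "(\<lambda>z. 1 / of_real (sqrt (2 * pi)) * exp ((1 / 2 - z) * Ln z) * exp z * Gamma z)
               holomorphic_on - \<real>\<^sub>\<le>\<^sub>0"
    by (intro holomorphic_intros) (auto dest: subsetD[OF nonpos_Ints_subset_nonpos_Reals])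
  then show ?thesis
    by (rule holomorphic_transform) (auto simp: stirling_factor_def powr_def)
qed

text \<open>On \<open>Re z > 0\<close> the direction \<open>0\<close> is admissible and the identity
  is \<open>stirling_factor_eq_exp_laplace\<close>. Both sides are holomorphic on the connected cut
  plane.\<close>

lemma stirling_factor_eq_exp_borel_sum:
  assumes F: "stirling_borel has_fps_expansion formal_borel \<phi>" and z: "z \<in> - \<real>\<^sub>\<le>\<^sub>0"
  shows "stirling_factor z = exp (borel_sum {- (pi / 2)<..<pi / 2} (\<lambda>_. 0) \<phi> z)"
proof (rule analytic_continuation_open[of "{z. Re z > 0}" "- \<real>\<^sub>\<le>\<^sub>0" stirling_factor
        "\<lambda>z. exp (borel_sum {- (pi / 2)<..<pi / 2} (\<lambda>_. 0) \<phi> z)"])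
  show "open {z. Re z > 0}" "{z. Re z > 0} \<noteq> {}"
    by (auto simp: open_halfspace_Re_gt intro!: exI[of _ 1])
  show "open (- \<real>\<^sub>\<le>\<^sub>0 :: complex set)" by (simp add: open_Compl)
  have "- \<real>\<^sub>\<le>\<^sub>0 = - (complex_of_real ` {..0})"
    by (auto simp: nonpos_Reals_def)
  then show "connected (- \<real>\<^sub>\<le>\<^sub>0 :: complex set)"
    using starlike_imp_connected[OF starlike_slotted_complex_plane_left[of 0]] by simp
  show "{z. Re z > 0} \<subseteq> - \<real>\<^sub>\<le>\<^sub>0" by (auto simp: complex_nonpos_Reals_iff)
  show "(\<lambda>z. exp (borel_sum {- (pi / 2)<..<pi / 2} (\<lambda>_. 0) \<phi> z)) holomorphic_on - \<real>\<^sub>\<le>\<^sub>0"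
    using holomorphic_on_borel_sum[OF F] unfolding borel_domain_right
    by (intro holomorphic_intros)
  show "stirling_factor w = exp (borel_sum {- (pi / 2)<..<pi / 2} (\<lambda>_. 0) \<phi> w)"
    if "w \<in> {z. Re z > 0}" for w
    using that borel_sum_eq_laplace[OF F, of 0 w] by (simp add: stirling_factor_eq_exp_laplace)
qed (use z holomorphic_on_stirling_factor in auto)

lemma formal_borel_in_borel_class:
  assumes F: "stirling_borel has_fps_expansion formal_borel \<phi>"
  shows "formal_borel \<phi> \<in> borel_class {- (pi / 2)<..<pi / 2} (\<lambda>_. 0)"
proof -
  let ?I = "{- (pi / 2)<..<pi / 2}"
  obtain C where C: "C > 0"
    "\<And>c \<zeta>. c > 0 \<Longrightarrow> Re \<zeta> \<ge> c * norm \<zeta> \<Longrightarrow> norm (stirling_borel \<zeta>) \<le> C + 3 / (1 - exp (- c))"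
    by (rule stirling_borel_bound) (rule that)
  \<comment> \<open>The ray in direction \<open>\<theta>\<close> lies in the cone with constant
    \<open>cos \<theta>\<close>, so \<open>stirling_borel_bound\<close> supplies this value.\<close>
  define \<alpha> where "\<alpha> = (\<lambda>\<theta>. C + 3 / (1 - exp (- cos \<theta>)))"
  have cos: "cos \<theta> > 0" if "\<theta> \<in> ?I" for \<theta>
    using that cos_gt_zero_pi by auto
  have pos: "\<alpha> \<theta> \<ge> 0" if "\<theta> \<in> ?I" for \<theta>
    using cos[OF that] C(1) by (simp add: \<alpha>_def)
  have "locally_bounded_on ?I \<alpha>"
    unfolding locally_bounded_on_def
  proof
    fix \<theta> :: real assume \<theta>: "\<theta> \<in> ?I"
    \<comment> \<open>Half of \<open>cos \<theta>\<close> remains a lower bound for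
      \<open>cos\<close> near \<open>\<theta>\<close>, and the bound decreases as the cone constant
      grows.\<close>
    define c where "c = cos \<theta> / 2"
    have c: "c > 0" using cos[OF \<theta>] by (simp add: c_def)
    have "open {\<beta>. c < cos \<beta>}" by (intro open_Collect_less continuous_intros)
    moreover have "\<theta> \<in> {\<beta>. c < cos \<beta>}" using cos[OF \<theta>] by (simp add: c_def)
    moreover have "norm (\<alpha> \<beta>) \<le> C + 3 / (1 - exp (- c))" if "\<beta> \<in> {\<beta>. c < cos \<beta>} \<inter> ?I" for \<beta>
    proof -
      have "3 / (1 - exp (- cos \<beta>)) \<le> 3 / (1 - exp (- c))"
        using that c by (intro divide_left_mono mult_pos_pos) auto
      then show ?thesis using pos[of \<beta>] that by (simp add: \<alpha>_def)
    qed
    then have "bounded (\<alpha> ` ({\<beta>. c < cos \<beta>} \<inter> ?I))"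
      unfolding bounded_iff by blast
    ultimately show "\<exists>U. open U \<and> \<theta> \<in> U \<and> bounded (\<alpha> ` (U \<inter> ?I))" by blast
  qed
  moreover have "continues_germ_to stirling_borel (formal_borel \<phi>) (open_sector ?I)"
    by (rule stirling_borel_continues_germ_to_sector[OF F])
  moreover have "norm (stirling_borel (of_real \<xi> * cis \<theta>)) \<le> \<alpha> \<theta> * exp (0 * \<xi>)"
    if "\<xi> > 0" "\<theta> \<in> ?I" for \<xi> \<theta>
    using C(2)[OF cos[OF that(2)], of "of_real \<xi> * cis \<theta>"] that by (simp add: \<alpha>_def norm_mult)
  ultimately show ?thesis
    unfolding borel_class_def using pos by blast
qed

theorem theorem11p2:
  fixes I :: "real set"
  defines "I \<equiv> {- (pi / 2)<..<pi / 2}"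
  shows "\<exists>\<mu> :: complex fps.
     fps_nth \<mu> 0 = 0 \<and> fps_divergent \<mu> \<and> fps_odd \<mu> \<and> one_summable I \<mu> \<and>
     formal_borel \<mu> \<in> borel_class I (\<lambda>_. 0) \<and>
     (\<exists>M. continues_germ_to M (formal_borel \<mu>) (- imaginary_cuts) \<and>
          (\<forall>\<zeta> \<in> - imaginary_cuts - {0}.
              M \<zeta> = 1 / \<zeta>\<^sup>2 * (\<zeta> / 2 * coth (\<zeta> / 2) - 1))) \<and>
     borel_domain I (\<lambda>_. 0) = - \<real>\<^sub>\<le>\<^sub>0 \<and>
     borel_sum I (\<lambda>_. 0) \<mu> holomorphic_on borel_domain I (\<lambda>_. 0) \<and>
     (\<forall>z \<in> - \<real>\<^sub>\<le>\<^sub>0. stirling_factor z = exp (borel_sum I (\<lambda>_. 0) \<mu> z))"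
proof -
  obtain F where F: "stirling_borel has_fps_expansion F"
    using stirling_borel_has_fps_expansion by blast
  \<comment> \<open>Inverts the formal Borel transform: factorials are restored and indices move up
    by one, leaving the constant term \<open>0\<close>.\<close>
  define \<mu> where "\<mu> = Abs_fps (\<lambda>n. if n = 0 then 0 else fps_nth F (n - 1) * fact (n - 1))"
  have \<mu>: "formal_borel \<mu> = F"
    by (simp add: fps_eq_iff formal_borel_def \<mu>_def)
  have germ: "stirling_borel has_fps_expansion formal_borel \<mu>"
    unfolding \<mu> by (rule F)
  have "(stirling_borel \<circ> (\<lambda>\<zeta>. - \<zeta>)) has_fps_expansion fps_compose F (- fps_X)"
    by (intro fps_expansion_intros F) simp
  then have "fps_compose F (- fps_X) = F"
    using fps_expansion_unique_complex F by (simp add: o_def stirling_borel_minus)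
  \<comment> \<open>\<open>stirling_borel\<close> is even, so \<open>F\<close> is; the index shift
    by one in \<open>\<mu>\<close> turns evenness into oddness.\<close>
  then have even: "(- 1) ^ n * fps_nth F n = fps_nth F n" for n
    by (simp add: fps_compose_uminus' fps_eq_iff)
  have "fps_odd \<mu>"
    unfolding fps_odd_def fps_compose_uminus' fps_eq_iff
  proof
    fix n
    show "Abs_fps (\<lambda>n. (- 1) ^ n * fps_nth \<mu> n) $ n = (- \<mu>) $ n"
      using even[of "n - 1"] by (cases n) (simp_all add: \<mu>_def mult.assoc[symmetric])
  qed
  moreover have "fps_divergent \<mu>"
    using stirling_borel_not_entire[OF germ] by (rule fps_divergent_of_formal_borel)
  moreover have cl: "formal_borel \<mu> \<in> borel_class I (\<lambda>_. 0)"
    unfolding I_def by (rule formal_borel_in_borel_class[OF germ])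
  moreover have "locally_bounded_on I (\<lambda>_. 0)"
    unfolding locally_bounded_on_def
    by (intro ballI exI[of _ UNIV] conjI open_UNIV UNIV_I) (rule bounded_subset[of "{0}"], auto)
  moreover have "\<exists>M. continues_germ_to M (formal_borel \<mu>) (- imaginary_cuts) \<and>
          (\<forall>\<zeta> \<in> - imaginary_cuts - {0}. M \<zeta> = 1 / \<zeta>\<^sup>2 * (\<zeta> / 2 * coth (\<zeta> / 2) - 1))"
    by (rule exI[of _ stirling_borel])
       (use germ holomorphic_on_stirling_borel in \<open>auto simp: continues_germ_to_def stirling_borel_def\<close>)
  moreover have "fps_nth \<mu> 0 = 0" by (simp add: \<mu>_def)
  ultimately have "fps_nth \<mu> 0 = 0 \<and> fps_divergent \<mu> \<and> fps_odd \<mu> \<and> one_summable I \<mu> \<and>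
     formal_borel \<mu> \<in> borel_class I (\<lambda>_. 0) \<and>
     (\<exists>M. continues_germ_to M (formal_borel \<mu>) (- imaginary_cuts) \<and>
          (\<forall>\<zeta> \<in> - imaginary_cuts - {0}.
              M \<zeta> = 1 / \<zeta>\<^sup>2 * (\<zeta> / 2 * coth (\<zeta> / 2) - 1)))"
    unfolding one_summable_def by blast
  then show ?thesis
    using borel_domain_right holomorphic_on_borel_sum[OF germ] stirling_factor_eq_exp_borel_sum[OF germ]
    unfolding I_def by blast
qed

end
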